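(* Let $G$ be a strongly connected signed digraph on $[n]$ without positive cycles which is not a cycle. Then at least one and-or-net on $G$ has a synchronizing word of length at most $5n(\sqrt{2})^n$.
   Context: A signed digraph on $V$ is $(V,E)$ with $E\subseteq V\times V\times\{-1,1\}$ (arc from $j$ to $i$ of sign $s$; loops allowed, both signs between the same pair allowed). Cycles have no repeated vertices (a loop is a cycle); the sign of a cycle is the product of its arc signs. "$G$ is a cycle" means $G$ itself is a single cycle. A Boolean network (BN) is $f:\{0,1\}^V\to\{0,1\}^V$; its signed interaction digraph has a positive (negative) arc from $j$ to $i$ iff for some $x$ with $x_j=0$, $f_i(x+e_j)-f_i(x)$ is positive (negative). A BN on $G$ is one whose signed interaction digraph is $G$. An and-or-net on $G$ is a BN on $G$ in which each $f_i$ is a conjunction ($f_i(x)=1$ iff $x_j=1$ for all positive in-neighbors $j$ and $x_j=0$ for all negative in-neighbors $j$ of $i$) or a disjunction ($f_i(x)=0$ iff $x_j=0$ for all positive and $x_j=1$ for all negative in-neighbors $j$). $f^i(x)$ is $x$ with $x_i$ replaced by $f_i(x)$; $f^{i_1\cdots i_\ell}=f^{i_\ell}\circ\cdots\circ f^{i_1}$; a word $w$ is synchronizing for $f$ if $f^w$ is constant. *)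

theory Defs
  imports Complex_Main "HOL-Library.Cardinality"
begin

text \<open>Vertices are the elements of a finite type 'v, so V = UNIV and n = CARD('v).
  A signed arc from j to i of sign s is the triple (j, i, s).
  A configuration is a map 'v => bool (True = 1, False = 0).\<close>

type_synonym 'v sdigraph = "('v \<times> 'v \<times> int) set"

definition signed_digraph :: "'v sdigraph \<Rightarrow> bool" where
  "signed_digraph E \<longleftrightarrow> (\<forall>(j, i, s) \<in> E. s = 1 \<or> s = -1)"

text \<open>Underlying (unsigned) arc relation and strong connectivity.\<close>
definition arcs :: "'v sdigraph \<Rightarrow> ('v \<times> 'v) set" where
  "arcs E = {(j, i). \<exists>s. (j, i, s) \<in> E}"

definition strongly_connected :: "'v sdigraph \<Rightarrow> bool" where
  "strongly_connected E \<longleftrightarrow> (\<forall>u v. (u, v) \<in> (arcs E)\<^sup>*)"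

text \<open>A cycle of E: distinct vertices vs = [v_0,...,v_{k-1}] (k >= 1) and signs ss
  with arcs (v_m, v_{m+1 mod k}, ss!m) in E. Its sign is the product of ss.\<close>
definition is_cycle :: "'v sdigraph \<Rightarrow> 'v list \<Rightarrow> int list \<Rightarrow> bool" where
  "is_cycle E vs ss \<longleftrightarrow> vs \<noteq> [] \<and> length ss = length vs \<and> distinct vs \<and>
     (\<forall>m < length vs. (vs ! m, vs ! ((m + 1) mod length vs), ss ! m) \<in> E)"

definition has_positive_cycle :: "'v sdigraph \<Rightarrow> bool" where
  "has_positive_cycle E \<longleftrightarrow> (\<exists>vs ss. is_cycle E vs ss \<and> prod_list ss = 1)"

text \<open>G is itself a single cycle: its vertex set and arc set are exactly those of a cycle.\<close>
definition digraph_is_cycle :: "'v sdigraph \<Rightarrow> bool" where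
  "digraph_is_cycle E \<longleftrightarrow> (\<exists>vs ss. is_cycle E vs ss \<and> set vs = UNIV \<and>
     E = {(vs ! m, vs ! ((m + 1) mod length vs), ss ! m) | m. m < length vs})"

text \<open>Boolean networks and their signed interaction digraph.\<close>
type_synonym 'v bn = "('v \<Rightarrow> bool) \<Rightarrow> ('v \<Rightarrow> bool)"

definition interaction_digraph :: "'v bn \<Rightarrow> 'v sdigraph" where
  "interaction_digraph f =
     {(j, i, 1) | j i. \<exists>x. \<not> x j \<and> \<not> f x i \<and> f (x(j := True)) i} \<union>
     {(j, i, -1) | j i. \<exists>x. \<not> x j \<and> f x i \<and> \<not> f (x(j := True)) i}"

definition is_conjunction :: "'v sdigraph \<Rightarrow> 'v bn \<Rightarrow> 'v \<Rightarrow> bool" where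
  "is_conjunction E f i \<longleftrightarrow> (\<forall>x. f x i \<longleftrightarrow>
     (\<forall>j. (j, i, 1) \<in> E \<longrightarrow> x j) \<and> (\<forall>j. (j, i, -1) \<in> E \<longrightarrow> \<not> x j))"

definition is_disjunction :: "'v sdigraph \<Rightarrow> 'v bn \<Rightarrow> 'v \<Rightarrow> bool" where
  "is_disjunction E f i \<longleftrightarrow> (\<forall>x. \<not> f x i \<longleftrightarrow>
     (\<forall>j. (j, i, 1) \<in> E \<longrightarrow> \<not> x j) \<and> (\<forall>j. (j, i, -1) \<in> E \<longrightarrow> x j))"

definition and_or_net :: "'v sdigraph \<Rightarrow> 'v bn \<Rightarrow> bool" where
  "and_or_net E f \<longleftrightarrow> interaction_digraph f = E \<and>
     (\<forall>i. is_conjunction E f i \<or> is_disjunction E f i)"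

text \<open>Asynchronous update f^i and f^w with f^{i_1...i_l} = f^{i_l} o ... o f^{i_1}.\<close>
definition update :: "'v bn \<Rightarrow> 'v \<Rightarrow> ('v \<Rightarrow> bool) \<Rightarrow> ('v \<Rightarrow> bool)" where
  "update f i x = x(i := f x i)"

definition word_update :: "'v bn \<Rightarrow> 'v list \<Rightarrow> ('v \<Rightarrow> bool) \<Rightarrow> ('v \<Rightarrow> bool)" where
  "word_update f w = fold (update f) w"

definition synchronizing :: "'v bn \<Rightarrow> 'v list \<Rightarrow> bool" where
  "synchronizing f w \<longleftrightarrow> (\<exists>c. \<forall>x. word_update f w x = c)"

end

theory Submission
  imports Defs
begin

text \<open>
  Fix a root \<open>r\<close> with at least two in-neighbours, carrying a loop if some vertex does. Switching signs
  along a depth-first search tree makes every vertex reachable from \<open>r\<close> by positive arcs; all arcs into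
  \<open>r\<close> are then negative. In these coordinates we let every local function be a disjunction. If
  \<open>x\<^sub>r = 1\<close>, updating the other vertices in a topological order of the positive arcs (a sweep) leads to the
  all-one state, which is fixed by all words avoiding \<open>r\<close>. Using the two in-neighbours of \<open>r\<close>, for every
  state \<open>y\<close> some word of length at most \<open>4n\<close> sends both \<open>y\<close> and the all-one state to the all-one state.
  Hence a set \<open>X\<close> of states containing it is synchronized in \<open>4n (|X| - 1)\<close> steps.

  It remains to reach a small \<open>X\<close> in \<open>2n\<close> steps. If \<open>r\<close> has a loop, a sweep, \<open>r\<close> and another
  sweep leave at most two states. If there are no loops, a sweep makes the zero set closed under positive
  predecessors, and updating the complement of a feedback vertex set \<open>F \<union> {r}\<close> makes the state
  a function of its restriction to \<open>F \<union> {r}\<close>. Induction along the search tree provides an \<open>F\<close> on which the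
  closed sets have at most \<open>(\<surd>2)\<^bsup>n-1\<^esup>\<close> traces.
\<close>


section \<open>Switching and asynchronous words\<close>

text \<open>
  After switching by \<open>\<sigma>\<close>, an arc from \<open>j\<close> to \<open>i\<close> of sign \<open>s\<close> has sign \<open>s\<close> if
  \<open>\<sigma> j = \<sigma> i\<close> and \<open>-s\<close> otherwise; \<open>same\<close> and \<open>diff\<close> collect the positive and the negative arcs of
  the switched digraph. Switching preserves the signs of cycles.
\<close>

definition same :: "'v sdigraph \<Rightarrow> ('v \<Rightarrow> bool) \<Rightarrow> ('v \<times> 'v) set" where
  "same E \<sigma> = {(u, v). \<exists>s. (u, v, s) \<in> E \<and> (s = 1 \<longleftrightarrow> \<sigma> u = \<sigma> v)}"

definition diff :: "'v sdigraph \<Rightarrow> ('v \<Rightarrow> bool) \<Rightarrow> ('v \<times> 'v) set" where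
  "diff E \<sigma> = {(u, v). \<exists>s. (u, v, s) \<in> E \<and> (s = 1 \<longleftrightarrow> \<sigma> u \<noteq> \<sigma> v)}"

definition net :: "('v \<times> 'v) set \<Rightarrow> ('v \<times> 'v) set \<Rightarrow> 'v bn" where
  "net P N x i \<longleftrightarrow> (\<exists>j. (j, i) \<in> P \<and> x j) \<or> (\<exists>j. (j, i) \<in> N \<and> \<not> x j)"

lemma word_update_append [simp]: "word_update f (u @ w) x = word_update f w (word_update f u x)"
  by (simp add: word_update_def)

lemma word_update_Nil [simp]: "word_update f [] x = x"
  by (simp add: word_update_def)

lemma word_update_Cons [simp]: "word_update f (i # w) x = word_update f w (x(i := f x i))"
  by (simp add: word_update_def update_def)

lemma word_update_notin: "i \<notin> set w \<Longrightarrow> word_update f w x i = x i"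
  by (induction w arbitrary: x) auto

section \<open>Cycles, signs and topological orders\<close>

text \<open>A closed walk of least positive length repeats no vertex, since a repetition would cut
  out a shorter closed walk. The indexing modulo the length is that of
  \<open>is_cycle\<close>.\<close>

lemma cyclic_imp_simple_cycle:
  assumes "\<not> acyclic R"
  obtains vs where "vs \<noteq> []" "distinct vs"
    "\<And>m. m < length vs \<Longrightarrow> (vs ! m, vs ! ((m + 1) mod length vs)) \<in> R"
proof -
  define Q where "Q = (\<lambda>n. n > 0 \<and> (\<exists>x. (x, x) \<in> R ^^ n))"
  have "\<exists>n. Q n"
    using assms by (auto simp: acyclic_def trancl_power Q_def)
  then have Qn: "Q (LEAST n. Q n)" and least: "\<And>m. m < (LEAST n. Q n) \<Longrightarrow> \<not> Q m"
    by (auto intro: LeastI_ex dest: not_less_Least)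
  define n where "n = (LEAST n. Q n)"
  obtain x where n0: "n > 0" and x: "(x, x) \<in> R ^^ n"
    using Qn by (auto simp: n_def Q_def)
  obtain g where g: "g 0 = x" "g n = x" "\<And>i. i < n \<Longrightarrow> (g i, g (Suc i)) \<in> R"
    using x by (auto simp: relpow_fun_conv)
  have inj: "g i \<noteq> g j" if "i < j" "j < n" for i j
  proof
    assume eq: "g i = g j"
    have "(g i, g j) \<in> R ^^ (j - i)"
      unfolding relpow_fun_conv
      by (rule exI[of _ "\<lambda>k. g (i + k)"]) (use that g(3) in auto)
    then have "Q (j - i)"
      using that eq by (auto simp: Q_def)
    moreover have "j - i < n" using that by auto
    ultimately show False using least n_def by blast
  qed
  show ?thesis
  proof (rule that[of "map g [0..<n]"])
    show "map g [0..<n] \<noteq> []" using n0 by simp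
    show "distinct (map g [0..<n])"
      by (auto simp: distinct_map inj_on_def) (metis inj linorder_neqE_nat)
    fix m assume m: "m < length (map g [0..<n])"
    show "(map g [0..<n] ! m, map g [0..<n] ! ((m + 1) mod length (map g [0..<n]))) \<in> R"
    proof (cases "Suc m = n")
      case True
      then show ?thesis using g n0 g(3)[of m] m by simp
    next
      case False
      then show ?thesis using g(3)[of m] m by simp
    qed
  qed
qed

text \<open>The product telescopes: each factor records whether \<tau> changes in one step, so only
  the two ends matter.\<close>

lemma prod_list_sign:
  fixes \<tau> :: "nat \<Rightarrow> bool"
  assumes "\<And>m. m < n \<Longrightarrow> (h m :: int) = (if \<tau> m = \<tau> (Suc m) then 1 else -1)"
  shows "prod_list (map h [0..<n]) = (if \<tau> 0 = \<tau> n then 1 else -1)"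
  using assms
proof (induction n)
  case (Suc n)
  have h1: "prod_list (map h [0..<n]) = (if \<tau> 0 = \<tau> n then 1 else -1)"
    by (rule Suc.IH) (simp add: Suc.prems)
  have h2: "h n = (if \<tau> n = \<tau> (Suc n) then 1 else -1)"
    by (rule Suc.prems) simp
  show ?case
    by (cases "\<tau> 0"; cases "\<tau> n"; cases "\<tau> (Suc n)") (simp_all add: h1 h2)
qed simp

lemma acyclic_same:
  assumes "signed_digraph E" and "\<not> has_positive_cycle E"
  shows "acyclic (same E \<sigma>)"
proof (rule ccontr)
  assume "\<not> acyclic (same E \<sigma>)"
  then obtain vs where vs: "vs \<noteq> []" "distinct vs"
    "\<And>m. m < length vs \<Longrightarrow> (vs ! m, vs ! ((m + 1) mod length vs)) \<in> same E \<sigma>"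
    by (rule cyclic_imp_simple_cycle) blast
  define n where "n = length vs"
  \<comment> \<open>Reducing the index modulo \<open>n\<close> gives
    \<open>\<tau> n = \<tau> 0\<close>, so the telescoping product of the arc signs is 1.\<close>
  define \<tau> where "\<tau> = (\<lambda>m. \<sigma> (vs ! (m mod n)))"
  define h where "h = (\<lambda>m. if \<tau> m = \<tau> (Suc m) then 1 else -1 :: int)"
  have h: "(vs ! m, vs ! ((m + 1) mod n), h m) \<in> E" if m: "m < n" for m
  proof -
    obtain s where s: "(vs ! m, vs ! ((m + 1) mod n), s) \<in> E"
      "s = 1 \<longleftrightarrow> \<sigma> (vs ! m) = \<sigma> (vs ! ((m + 1) mod n))"
      using vs(3)[of m] m unfolding same_def n_def by blast
    have "s = 1 \<or> s = -1"
      using assms(1) s(1) by (force simp: signed_digraph_def)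
    then have "s = h m"
      using s(2) that by (auto simp: h_def \<tau>_def)
    then show ?thesis using s(1) by simp
  qed
  have "is_cycle E vs (map h [0..<n])"
    using vs h by (auto simp: is_cycle_def n_def)
  moreover have "prod_list (map h [0..<n]) = 1"
    using prod_list_sign[of n h \<tau>] by (simp add: h_def \<tau>_def)
  ultimately show False
    using assms(2) by (auto simp: has_positive_cycle_def)
qed

text \<open>Minimal elements of \<open>S\<close> are removed one after another. Ordering by the
  transitive closure respects whole paths, also those through vertices outside
  \<open>S\<close>.\<close>

lemma topological_order:
  fixes R :: "('v::finite \<times> 'v) set"
  assumes "acyclic R"
  shows "\<exists>xs. distinct xs \<and> set xs = S \<and> sorted_wrt (\<lambda>u v. (v, u) \<notin> R\<^sup>+) xs"
proof (induction "card S" arbitrary: S)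
  case 0
  then show ?case by auto
next
  case (Suc n)
  have wf: "wf (R\<^sup>+)"
    using assms by (simp add: finite_acyclic_wf wf_trancl)
  have "S \<noteq> {}" using Suc.hyps(2) by auto
  then obtain m where m: "m \<in> S" "\<And>y. (y, m) \<in> R\<^sup>+ \<Longrightarrow> y \<notin> S"
    using wfE_min'[OF wf, of S] by metis
  have "n = card (S - {m})"
    using Suc.hyps(2) m by simp
  then obtain ys where "distinct ys" "set ys = S - {m}" "sorted_wrt (\<lambda>u v. (v, u) \<notin> R\<^sup>+) ys"
    using Suc.hyps(1) by blast
  then show ?case
    using m by (intro exI[of _ "m # ys"]) auto
qed

lemma sorted_wrt_split_before:
  assumes "sorted_wrt (\<lambda>u v. (v, u) \<notin> R\<^sup>+) (p @ w # q)" "acyclic R" "(u, w) \<in> R"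
    "u \<in> set (p @ w # q)"
  shows "u \<in> set p"
proof -
  have "u \<noteq> w" using assms(2,3) by (auto simp: acyclic_def)
  moreover have "u \<notin> set q" using assms(1,3) by (auto simp: sorted_wrt_append)
  ultimately show ?thesis using assms(4) by auto
qed

text \<open>With its forward counterpart below, this keeps a path on one side of a switched set,
  where switching does not alter the signs of its arcs.\<close>

lemma rtrancl_restrict_pred_closed:
  assumes "(x, y) \<in> R\<^sup>*" "y \<in> Q" "\<And>u v. (u, v) \<in> R \<Longrightarrow> v \<in> Q \<Longrightarrow> u \<in> Q"
  shows "(x, y) \<in> (R \<inter> Q \<times> Q)\<^sup>* \<and> x \<in> Q"
  using assms(1)
proof (induction rule: converse_rtrancl_induct)
  case base
  then show ?case using assms(2) by auto
next
  case (step y' z')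
  then have "(y', z') \<in> R \<inter> Q \<times> Q"
    using assms(3) by auto
  then show ?case
    using step.IH by (auto intro: converse_rtrancl_into_rtrancl)
qed

lemma rtrancl_restrict_succ_closed:
  assumes "(x, y) \<in> R\<^sup>*" "x \<in> Q" "\<And>u v. (u, v) \<in> R \<Longrightarrow> u \<in> Q \<Longrightarrow> v \<in> Q"
  shows "(x, y) \<in> (R \<inter> Q \<times> Q)\<^sup>* \<and> y \<in> Q"
  using assms(1)
proof (induction rule: rtrancl_induct)
  case base
  then show ?case using assms(2) by auto
next
  case (step y' z')
  then have "(y', z') \<in> R \<inter> Q \<times> Q"
    using assms(3) by auto
  then show ?case
    using step.IH by (auto intro: rtrancl_into_rtrancl)
qed

section \<open>Dynamics of the disjunctive network with a root\<close>

text \<open>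
  For a switched digraph with positive arcs \<open>P\<close> and negative arcs \<open>N\<close>, the absence of positive cycles
  is used in the form: every further switching (of a set \<open>Q\<close>) makes the positive arcs acyclic.
\<close>

locale rooted_net =
  fixes P N :: "('v::finite \<times> 'v) set" and r :: 'v
  assumes no_pos: "acyclic ({(u, v) \<in> P. u \<in> Q \<longleftrightarrow> v \<in> Q} \<union> {(u, v) \<in> N. \<not> (u \<in> Q \<longleftrightarrow> v \<in> Q)})"
    and root: "(r, v) \<in> P\<^sup>*"
begin

abbreviation "g \<equiv> net P N"
abbreviation "top_state \<equiv> (\<lambda>_::'v. True)"

lemma acyclic_P: "acyclic P"
  using no_pos[of UNIV] by simp

lemma no_P_into_root: "(u, r) \<notin> P"
  using root[of u] acyclic_P by (auto simp: acyclic_def dest: rtrancl_into_trancl1)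

lemma has_P_pred: "v \<noteq> r \<Longrightarrow> \<exists>u. (u, v) \<in> P"
  using root[of v] by (metis rtranclE)

text \<open>Switching \<open>Q\<close> would turn \<open>r \<rightarrow> \<dots> \<rightarrow> w \<rightarrow> a \<rightarrow> \<dots> \<rightarrow> j \<rightarrow> r\<close> into a cycle of positive arcs.\<close>

lemma switch_cycle:
  assumes Q: "\<And>u v. (u, v) \<in> P \<Longrightarrow> v \<in> Q \<Longrightarrow> u \<in> Q"
    and w: "w \<in> Q" and a: "a \<notin> Q" and wa: "(w, a) \<in> N" and aj: "(a, j) \<in> P\<^sup>*" and jr: "(j, r) \<in> N"
  shows False
proof -
  define R where "R = {(u, v) \<in> P. u \<in> Q \<longleftrightarrow> v \<in> Q} \<union> {(u, v) \<in> N. \<not> (u \<in> Q \<longleftrightarrow> v \<in> Q)}"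
  have rw: "(r, w) \<in> (P \<inter> Q \<times> Q)\<^sup>* \<and> r \<in> Q"
    using rtrancl_restrict_pred_closed[OF root w Q] .
  have aj': "(a, j) \<in> (P \<inter> (-Q) \<times> (-Q))\<^sup>* \<and> j \<in> -Q"
    using rtrancl_restrict_succ_closed[OF aj, of "-Q"] a Q by auto
  have "(r, w) \<in> R\<^sup>*"
    using rw rtrancl_mono[of "P \<inter> Q \<times> Q" R] by (auto simp: R_def)
  moreover have "(w, a) \<in> R"
    using wa w a by (auto simp: R_def)
  moreover have "(a, j) \<in> R\<^sup>*"
    using aj' rtrancl_mono[of "P \<inter> (-Q) \<times> (-Q)" R] by (auto simp: R_def)
  moreover have "(j, r) \<in> R"
    using jr aj' rw by (auto simp: R_def)
  ultimately have "(r, r) \<in> R\<^sup>+"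
    by (meson rtrancl_into_trancl1 rtrancl_into_rtrancl rtrancl_trans)
  then show False
    using no_pos[of Q] by (auto simp: acyclic_def R_def)
qed

definition ord :: "'v list" where
  "ord = (SOME xs. distinct xs \<and> set xs = UNIV \<and> sorted_wrt (\<lambda>u v. (v, u) \<notin> P\<^sup>+) xs)"

lemma ord: "distinct ord" "set ord = UNIV" "sorted_wrt (\<lambda>u v. (v, u) \<notin> P\<^sup>+) ord"
  using someI_ex[OF topological_order[OF acyclic_P, of UNIV]] by (simp_all add: ord_def)

lemma length_ord: "length ord = CARD('v)"
  using distinct_card[OF ord(1)] ord(2) by simp

definition sweep :: "'v list" where
  "sweep = filter (\<lambda>v. v \<noteq> r) ord"

lemma length_filter_ord:
  assumes "\<And>v. S v \<Longrightarrow> v \<noteq> r"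
  shows "length (filter S ord) < CARD('v)"
  using length_filter_less[of r ord S] assms ord(2) length_ord by auto

lemma length_sweep: "length sweep < CARD('v)"
  unfolding sweep_def by (rule length_filter_ord)

text \<open>The invariant covers the arcs into the processed prefix. Updating \<open>w\<close> makes
  it 1 as soon as one positive predecessor is 1, and it breaks no earlier arc because
  \<open>w\<close> has no positive arc to itself or into the prefix.\<close>

lemma sweep_closed:
  assumes "(u, v) \<in> P" "word_update g sweep x u"
  shows "word_update g sweep x v"
proof -
  have "\<forall>(u, v) \<in> P. v \<in> set p \<longrightarrow> word_update g (filter (\<lambda>v. v \<noteq> r) p) x u \<longrightarrow>
      word_update g (filter (\<lambda>v. v \<noteq> r) p) x v"
    if "ord = p @ q" for p q
    using that
  proof (induction p arbitrary: q rule: rev_induct)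
    case Nil
    then show ?case by auto
  next
    case (snoc w p)
    have IH: "\<forall>(u, v) \<in> P. v \<in> set p \<longrightarrow> word_update g (filter (\<lambda>v. v \<noteq> r) p) x u \<longrightarrow>
      word_update g (filter (\<lambda>v. v \<noteq> r) p) x v"
      using snoc.IH[of "w # q"] snoc.prems by simp
    show ?case
    proof (cases "w = r")
      case True
      then show ?thesis using IH no_P_into_root by auto
    next
      case False
      have wp: "(w, v) \<notin> P" if "v \<in> set p" for v
        using that ord(3) by (auto simp: snoc.prems sorted_wrt_append)
      have ww: "(w, w) \<notin> P"
        using acyclic_P by (auto simp: acyclic_def)
      have wnp: "w \<notin> set p"
        using ord(1) by (auto simp: snoc.prems)
      define y where "y = word_update g (filter (\<lambda>v. v \<noteq> r) p) x"
      have IHy: "y v" if "(u, v) \<in> P" "v \<in> set p" "y u" for u v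
        using IH that unfolding y_def by blast
      have step: "(y(w := g y w)) v" if "(u, v) \<in> P" "v \<in> set (p @ [w])" "(y(w := g y w)) u" for u v
      proof (cases "v = w")
        case True
        then show ?thesis
          using that ww by (auto simp: net_def split: if_splits)
      next
        case False
        then have "v \<in> set p" "u \<noteq> w" using that wp by auto
        then show ?thesis using that IHy False by auto
      qed
      have eq: "word_update g (filter (\<lambda>v. v \<noteq> r) (p @ [w])) x = y(w := g y w)"
        using False by (simp add: y_def)
      show ?thesis
        unfolding eq using step by blast
    qed
  qed
  from this[of ord "[]"] show ?thesis
    using assms ord(2) by (auto simp: sweep_def)
qed

lemma sweep_root: "word_update g sweep x r = x r"
  by (rule word_update_notin) (simp add: sweep_def)

lemma sweep_top:
  assumes "x r"
  shows "word_update g sweep x = top_state"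
proof
  fix v
  show "word_update g sweep x v = True"
    using root[of v]
  proof (induction rule: rtrancl_induct)
    case base
    then show ?case using assms sweep_root by simp
  next
    case (step y z)
    then show ?case using sweep_closed by blast
  qed
qed

text \<open>Every vertex other than the root has a positive in-neighbour, and its value 1 already
  makes the disjunction true.\<close>

lemma top_fixed:
  assumes "r \<notin> set w"
  shows "word_update g w top_state = top_state"
  using assms
proof (induction w)
  case (Cons i w)
  then have "g top_state i"
    using has_P_pred[of i] by (auto simp: net_def)
  then show ?case using Cons by (simp add: fun_upd_def)
qed simp

text \<open>This is how an in-neighbour of the root is set to 0 without touching the root or any
  vertex outside its positive ancestors. When \<open>a\<close> is updated, its positive
  in-neighbours are already 0, and a negative in-neighbour with value 0 would create a positive
  cycle through the root or contradict the order.\<close>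

lemma lower:
  assumes yr: "\<not> y r" and cl: "\<And>i. i \<noteq> r \<Longrightarrow> \<not> y i \<Longrightarrow> \<not> g y i"
    and J: "\<And>j. j \<in> J \<Longrightarrow> (j, r) \<in> N"
  defines "A \<equiv> {a. y a \<and> (\<exists>j\<in>J. (a, j) \<in> P\<^sup>*)}"
  shows "word_update g (filter (\<lambda>a. a \<in> A) ord) y = (\<lambda>v. y v \<and> v \<notin> A)"
proof -
  have closed: "\<not> y u" if "(u, v) \<in> P" "\<not> y v" for u v
    using that cl[of v] no_P_into_root by (cases "v = r") (auto simp: net_def)
  have "word_update g (filter (\<lambda>a. a \<in> A) p) y = (\<lambda>v. y v \<and> \<not> (v \<in> set p \<and> v \<in> A))"
    if "ord = p @ q" for p q
    using that
  proof (induction p arbitrary: q rule: rev_induct)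
    case Nil
    then show ?case by auto
  next
    case (snoc a p)
    have IH: "word_update g (filter (\<lambda>a. a \<in> A) p) y = (\<lambda>v. y v \<and> \<not> (v \<in> set p \<and> v \<in> A))"
      using snoc.IH[of "a # q"] snoc.prems by simp
    show ?case
    proof (cases "a \<in> A")
      case False
      then show ?thesis using IH by (auto simp: fun_eq_iff)
    next
      case True
      then obtain j where j: "y a" "j \<in> J" "(a, j) \<in> P\<^sup>*" by (auto simp: A_def)
      have "\<not> g (\<lambda>v. y v \<and> \<not> (v \<in> set p \<and> v \<in> A)) a"
      proof
        assume "g (\<lambda>v. y v \<and> \<not> (v \<in> set p \<and> v \<in> A)) a"
        then consider u where "(u, a) \<in> P" "y u" "\<not> (u \<in> set p \<and> u \<in> A)"
          | u where "(u, a) \<in> N" "\<not> y u" | u where "(u, a) \<in> N" "u \<in> set p"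
          unfolding net_def by auto
        then show False
        proof cases
          case 1
          have "u \<in> set p"
            using sorted_wrt_split_before[of P p a q u] ord acyclic_P 1(1) snoc.prems by auto
          moreover have "u \<in> A"
            using 1 j by (auto simp: A_def intro: converse_rtrancl_into_rtrancl)
          ultimately show False using 1(3) by blast
        next
          case 2
          \<comment> \<open>The switched set is the zero set of \<open>y\<close>: it contains
            \<open>u\<close>, omits \<open>a\<close> and is closed under positive
            predecessors.\<close>
          show False
            by (rule switch_cycle[of "{v. \<not> y v}" u a j]) (use 2 j J closed in auto)
        next
          case 3
          \<comment> \<open>Here \<open>u\<close> was lowered before \<open>a\<close>. Switching the
            positive ancestors of \<open>u\<close> shows that \<open>a\<close> is one of them, so
            \<open>a\<close> should have come before \<open>u\<close> in \<open>ord\<close>.\<close>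
          have "(a, u) \<in> P\<^sup>*"
          proof (rule ccontr)
            assume "(a, u) \<notin> P\<^sup>*"
            then show False
              using switch_cycle[of "{v. (v, u) \<in> P\<^sup>*}" u a j] 3 j J
              by (auto intro: converse_rtrancl_into_rtrancl)
          qed
          moreover have "a \<noteq> u"
            using ord(1) 3 by (auto simp: snoc.prems)
          ultimately have "(a, u) \<in> P\<^sup>+"
            by (simp add: rtrancl_eq_or_trancl)
          then show False
            using ord(3) 3 by (auto simp: snoc.prems sorted_wrt_append)
        qed
      qed
      moreover have "word_update g (filter (\<lambda>a. a \<in> A) (p @ [a])) y =
          (\<lambda>v. y v \<and> \<not> (v \<in> set p \<and> v \<in> A))(a := g (\<lambda>v. y v \<and> \<not> (v \<in> set p \<and> v \<in> A)) a)"
        using True by (simp only: filter_append filter.simps if_True word_update_append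
          word_update_Cons word_update_Nil IH)
      ultimately show ?thesis
        using True by (auto simp: fun_eq_iff)
    qed
  qed
  from this[of ord "[]"] show ?thesis
    using ord(2) by simp
qed

text \<open>Zeros that an update would raise are raised greedily. Each step removes one zero and the
  root stays 0, so fewer than \<open>n\<close> steps suffice. The resulting state satisfies the
  stability hypothesis of \<open>lower\<close>.\<close>

lemma saturate:
  assumes "\<not> y r"
  shows "\<exists>u. r \<notin> set u \<and> length u < CARD('v) \<and> \<not> word_update g u y r \<and>
     (\<forall>i. i \<noteq> r \<longrightarrow> \<not> word_update g u y i \<longrightarrow> \<not> g (word_update g u y) i)"
proof -
  have "\<exists>u. r \<notin> set u \<and> length u < card {i. \<not> y i} \<and> \<not> word_update g u y r \<and>
     (\<forall>i. i \<noteq> r \<longrightarrow> \<not> word_update g u y i \<longrightarrow> \<not> g (word_update g u y) i)"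
    using assms
  proof (induction "card {i. \<not> y i}" arbitrary: y rule: less_induct)
    case less
    show ?case
    proof (cases "\<forall>i. i \<noteq> r \<longrightarrow> \<not> y i \<longrightarrow> \<not> g y i")
      case True
      have "card {i. \<not> y i} > 0"
        using less.prems by (auto simp: card_gt_0_iff)
      then show ?thesis
        using True less.prems by (intro exI[of _ "[]"]) auto
    next
      case False
      then obtain i where i: "i \<noteq> r" "\<not> y i" "g y i" by blast
      have "{k. \<not> (y(i := True)) k} \<subset> {k. \<not> y k}"
        using i by auto
      then have lt: "card {k. \<not> (y(i := True)) k} < card {k. \<not> y k}"
        by (intro psubset_card_mono) auto
      have "\<not> (y(i := True)) r" using less.prems i by simp
      then obtain u where u: "r \<notin> set u" "length u < card {k. \<not> (y(i := True)) k}"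
        "\<not> word_update g u (y(i := True)) r"
        "\<forall>k. k \<noteq> r \<longrightarrow> \<not> word_update g u (y(i := True)) k \<longrightarrow> \<not> g (word_update g u (y(i := True))) k"
        using less.hyps[OF lt] by blast
      show ?thesis
        using u lt i by (intro exI[of _ "i # u"]) auto
    qed
  qed
  moreover have "card {i. \<not> y i} \<le> CARD('v)"
    by (intro card_mono) auto
  ultimately show ?thesis
    by (meson less_le_trans)
qed

text \<open>
  Once \<open>y\<close> is lowered to a state with \<open>k = 0\<close>, the root is updated in both states. Lowering the ancestors
  of \<open>j\<close> then makes \<open>j = 0\<close> in the orbit of the all-one state, and leaves \<open>k\<close> alone in the orbit of \<open>y\<close>,
  so that the next update sets the root to 1 in both.
\<close>

lemma merge_with_top:
  assumes j: "(j1, r) \<in> N" "(j2, r) \<in> N" "j1 \<noteq> j2"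
  shows "\<exists>w. length w \<le> 4 * CARD('v) \<and> word_update g w y = top_state \<and> word_update g w top_state = top_state"
proof (cases "y r")
  case True
  then show ?thesis
    using sweep_top length_sweep by (intro exI[of _ sweep]) auto
next
  case False
  \<comment> \<open>Acyclicity makes \<open>P\<close>-reachability antisymmetric, so one of the two
    ways to name the in-neighbours works. The choice ensures that lowering the ancestors of
    \<open>j\<close> does not touch \<open>k\<close>.\<close>
  have "\<exists>j k. (j, r) \<in> N \<and> (k, r) \<in> N \<and> (k, j) \<notin> P\<^sup>*"
  proof (cases "(j2, j1) \<in> P\<^sup>*")
    case True
    have "(j1, j2) \<notin> P\<^sup>*"
      using True j(3) acyclic_P
      by (metis acyclic_impl_antisym_rtrancl antisym_def)
    then show ?thesis using j by blast
  qed (use j in blast)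
  then obtain j k where jk: "(j, r) \<in> N" "(k, r) \<in> N" "(k, j) \<notin> P\<^sup>*" by blast
  have kr: "k \<noteq> r" using jk(3) root by blast
  obtain u where u: "r \<notin> set u" "length u < CARD('v)" "\<not> word_update g u y r"
    "\<And>i. i \<noteq> r \<Longrightarrow> \<not> word_update g u y i \<Longrightarrow> \<not> g (word_update g u y) i"
    using saturate[of y] False by blast
  define y1 where "y1 = word_update g u y"
  define A1 where "A1 = {a. y1 a \<and> (\<exists>j\<in>{k}. (a, j) \<in> P\<^sup>*)}"
  define l1 where "l1 = filter (\<lambda>a. a \<in> A1) ord"
  have l1: "word_update g l1 y1 = (\<lambda>v. y1 v \<and> v \<notin> A1)"
    unfolding l1_def A1_def by (rule lower) (use u jk in \<open>auto simp: y1_def\<close>)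
  have rA1: "r \<notin> A1" using u(3) by (auto simp: A1_def y1_def)
  define y2 where "y2 = word_update g l1 y1"
  have y2: "\<not> y2 k" unfolding y2_def l1 by (auto simp: A1_def)
  \<comment> \<open>This is the all-one state after updating the root, whose in-arcs are all
    negative. Its only zero is the root, so the stability hypothesis of \<open>lower\<close> holds
    vacuously.\<close>
  define b where "b = top_state(r := False)"
  define A2 where "A2 = {a. b a \<and> (\<exists>j\<in>{j}. (a, j) \<in> P\<^sup>*)}"
  define l2 where "l2 = filter (\<lambda>a. a \<in> A2) ord"
  have l2: "word_update g l2 b = (\<lambda>v. b v \<and> v \<notin> A2)"
    unfolding l2_def A2_def by (rule lower) (use jk in \<open>auto simp: b_def\<close>)
  have rA2: "r \<notin> A2" by (auto simp: A2_def b_def)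
  have kA2: "k \<notin> A2" using jk by (auto simp: A2_def)
  define w where "w = u @ l1 @ [r] @ l2 @ [r] @ sweep"
  have "length l1 < CARD('v)"
    unfolding l1_def by (rule length_filter_ord) (use rA1 in auto)
  moreover have "length l2 < CARD('v)"
    unfolding l2_def by (rule length_filter_ord) (use rA2 in auto)
  \<comment> \<open>Four words of length at most \<open>n - 1\<close> and two single updates of the
    root.\<close>
  ultimately have len: "length w \<le> 4 * CARD('v)"
    using u(2) length_sweep by (simp add: w_def)
  \<comment> \<open>The word \<open>l2\<close> is designed for \<open>b\<close>; in the orbit of
    \<open>y\<close> it only matters that \<open>l2\<close> does not contain
    \<open>k\<close>.\<close>
  have "\<not> word_update g l2 (y2(r := g y2 r)) k"
    using y2 kr kA2 by (simp add: word_update_notin l2_def)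
  then have "g (word_update g l2 (y2(r := g y2 r))) r"
    using jk(2) by (auto simp: net_def)
  then have wy: "word_update g w y = top_state"
    by (simp add: w_def sweep_top flip: y1_def y2_def)
  have "\<not> g top_state r"
    using no_P_into_root by (auto simp: net_def)
  then have b: "top_state(r := g top_state r) = b" by (simp add: b_def)
  have "\<not> word_update g l2 b j"
    unfolding l2 by (auto simp: A2_def)
  then have "g (word_update g l2 b) r"
    using jk(1) by (auto simp: net_def)
  moreover have "word_update g u top_state = top_state" "word_update g l1 top_state = top_state"
    using u(1) rA1 by (auto intro!: top_fixed simp: l1_def)
  ultimately have "word_update g w top_state = top_state"
    by (simp add: w_def b sweep_top)
  with len wy show ?thesis by blast
qed

text \<open>A merging word sends one further state to the all-one state and fixes the latter, so the
  image loses at least one element and still contains the all-one state.\<close>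

lemma synchronize_set:
  assumes j: "(j1, r) \<in> N" "(j2, r) \<in> N" "j1 \<noteq> j2" and "top_state \<in> X"
  shows "\<exists>w. length w \<le> 4 * CARD('v) * (card X - 1) \<and> word_update g w ` X = {top_state}"
  using assms(4)
proof (induction "card X" arbitrary: X rule: less_induct)
  case less
  have fin: "finite X" by simp
  show ?case
  proof (cases "X = {top_state}")
    case True
    then show ?thesis by (intro exI[of _ "[]"]) auto
  next
    case False
    then obtain y where y: "y \<in> X" "y \<noteq> top_state" using less.prems by blast
    obtain w where w: "length w \<le> 4 * CARD('v)" "word_update g w y = top_state"
      "word_update g w top_state = top_state"
      using merge_with_top[OF j] by blast
    define Y where "Y = word_update g w ` X"
    have "X = insert y (X - {y})" "top_state \<in> X - {y}"
      using y less.prems by auto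
    then have "Y = word_update g w ` (X - {y})"
      unfolding Y_def using w(2,3) by (metis image_insert insert_absorb imageI)
    then have "card Y \<le> card (X - {y})"
      using card_image_le[of "X - {y}"] fin by simp
    moreover have cX: "card (X - {y}) = card X - 1" "card X > 0"
      using y by (auto simp: card_gt_0_iff)
    ultimately have cY: "card Y < card X" "card Y \<le> card X - 1" by linarith+
    have tY: "top_state \<in> Y"
      using less.prems w(3) unfolding Y_def by (metis imageI)
    obtain w' where w': "length w' \<le> 4 * CARD('v) * (card Y - 1)" "word_update g w' ` Y = {top_state}"
      using less.hyps[OF cY(1) tY] by blast
    have "card Y > 0" using tY by (auto simp: card_gt_0_iff)
    then have "1 + (card Y - 1) \<le> card X - 1" using cY by linarith
    then have "4 * CARD('v) * (1 + (card Y - 1)) \<le> 4 * CARD('v) * (card X - 1)"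
      by (rule mult_le_mono2)
    then have "length (w @ w') \<le> 4 * CARD('v) * (card X - 1)"
      using w(1) w'(1) by (simp add: algebra_simps)
    moreover have "word_update g (w @ w') ` X = {top_state}"
      using w'(2) by (simp add: Y_def image_image)
    ultimately show ?thesis by blast
  qed
qed

section \<open>Reaching a small set of states\<close>

text \<open>If the root is 1, the first sweep reaches the all-one state, after which everything is
  determined. If it is 0, the negative loop turns it to 1 and the second sweep reaches the all-one
  state.\<close>

lemma initial_loop:
  assumes "(r, r) \<in> N"
  shows "\<exists>w. length w \<le> 2 * CARD('v) \<and> card (range (word_update g w)) \<le> 2 \<and>
     top_state \<in> range (word_update g w)"
proof -
  define w where "w = sweep @ [r] @ sweep"
  define y where "y = word_update g sweep (top_state(r := False))"
  have "\<not> g top_state r"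
    using no_P_into_root by (auto simp: net_def)
  then have 1: "word_update g w x = y" if "x r" for x
    using that by (simp add: w_def sweep_top y_def)
  have 2: "word_update g w x = top_state" if "\<not> x r" for x
  proof -
    have "g (word_update g sweep x) r"
      using assms that sweep_root by (auto simp: net_def)
    then show ?thesis by (simp add: w_def sweep_top)
  qed
  have "range (word_update g w) \<subseteq> {y, top_state}"
    using 1 2 by blast
  then have "card (range (word_update g w)) \<le> card {y, top_state}"
    by (intro card_mono) auto
  also have "\<dots> \<le> 2"
    by (simp add: card_insert_if)
  finally have "card (range (word_update g w)) \<le> 2" .
  moreover have "top_state \<in> range (word_update g w)"
    using 2[of "\<lambda>_. False"] by (metis rangeI)
  moreover have "length w \<le> 2 * CARD('v)"
    using length_sweep by (simp add: w_def)
  ultimately show ?thesis by blast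
qed

text \<open>The summand 1 accounts for the states whose root is 1; the others are determined by the
  trace on \<open>F\<close> of a zero set closed under positive predecessors.\<close>

lemma initial_fvs:
  assumes F: "r \<notin> F" and ac: "acyclic ((P \<union> N) \<inter> (- F - {r}) \<times> (- F - {r}))"
  shows "\<exists>w. length w \<le> 2 * CARD('v) \<and> top_state \<in> range (word_update g w) \<and>
    card (range (word_update g w)) \<le> 1 + card ((\<lambda>Z. Z \<inter> F) ` {Z. \<forall>u. \<forall>v\<in>Z. (u, v) \<in> P \<longrightarrow> u \<in> Z})"
proof -
  define R where "R = (P \<union> N) \<inter> (- F - {r}) \<times> (- F - {r})"
  obtain fo where fo: "distinct fo" "set fo = - F - {r}" "sorted_wrt (\<lambda>u v. (v, u) \<notin> R\<^sup>+) fo"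
    using topological_order[of R "- F - {r}"] ac by (auto simp: R_def)
  define w where "w = sweep @ fo"
  \<comment> \<open>Along \<open>fo\<close>, each updated vertex has its in-neighbours in
    \<open>F\<close>, at the root, or earlier in \<open>fo\<close>, so the result depends only on
    the values on \<open>insert r F\<close>.\<close>
  have agree: "word_update g fo x = word_update g fo x'" if eq: "\<And>v. v \<in> insert r F \<Longrightarrow> x v = x' v" for x x'
  proof -
    have "\<forall>v \<in> insert r F \<union> set p. word_update g p x v = word_update g p x' v" if "fo = p @ q" for p q
      using that
    proof (induction p arbitrary: q rule: rev_induct)
      case Nil
      then show ?case using eq by auto
    next
      case (snoc a p)
      have IH: "\<forall>v \<in> insert r F \<union> set p. word_update g p x v = word_update g p x' v"
        using snoc.IH[of "a # q"] snoc.prems by simp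
      have "u \<in> insert r F \<union> set p" if "(u, a) \<in> P \<union> N" for u
      proof (rule ccontr)
        assume u: "u \<notin> insert r F \<union> set p"
        have "a \<in> set fo" by (simp add: snoc.prems)
        then have "(u, a) \<in> R" using that u fo(2) by (auto simp: R_def)
        moreover have "u \<in> set (p @ a # q)" using u fo(2) by (auto simp: snoc.prems)
        ultimately show False
          using sorted_wrt_split_before[of R p a q u] fo(3) ac u snoc.prems by (auto simp: R_def)
      qed
      then have "word_update g p x u = word_update g p x' u" if "(u, a) \<in> P \<union> N" for u
        using IH that by blast
      then have "g (word_update g p x) a = g (word_update g p x') a"
        using net_def[of P N "word_update g p x" a] net_def[of P N "word_update g p x'" a] by blast
      then show ?case using IH by auto
    qed
    from this[of fo "[]"] show ?thesis
      using fo(2) by auto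
  qed
  define K where "K = (\<lambda>Z. Z \<inter> F) ` {Z. \<forall>u. \<forall>v\<in>Z. (u, v) \<in> P \<longrightarrow> u \<in> Z}"
  \<comment> \<open>\<open>h C\<close> is the final state when \<open>C\<close> is the set of zeros
    on \<open>insert r F\<close>: \<open>C\<close> is empty if the root is 1 and contains
    \<open>r\<close> otherwise.\<close>
  define h where "h = (\<lambda>C. word_update g fo (\<lambda>v. v \<notin> C))"
  have "word_update g w x \<in> h ` (insert {} (insert r ` K))" for x
  proof -
    define y where "y = word_update g sweep x"
    define C where "C = {v. \<not> y v} \<inter> insert r F"
    have "word_update g w x = h C"
    proof -
      have "word_update g fo y = word_update g fo (\<lambda>v. v \<notin> C)"
        by (rule agree) (auto simp: C_def)
      then show ?thesis by (simp add: w_def h_def y_def)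
    qed
    moreover have "C \<in> insert {} (insert r ` K)"
    proof (cases "y r")
      case True
      then have "x r" using sweep_root by (simp add: y_def)
      then have "y = top_state" by (simp add: y_def sweep_top)
      then show ?thesis by (simp add: C_def)
    next
      case False
      have "{v. \<not> y v} \<inter> F \<in> K"
        unfolding K_def using sweep_closed[of _ _ x] by (intro imageI) (auto simp: y_def)
      moreover have "C = insert r ({v. \<not> y v} \<inter> F)"
        using False by (auto simp: C_def)
      ultimately show ?thesis by blast
    qed
    ultimately show ?thesis by blast
  qed
  then have "range (word_update g w) \<subseteq> h ` (insert {} (insert r ` K))" by blast
  then have "card (range (word_update g w)) \<le> card (h ` (insert {} (insert r ` K)))"
    by (intro card_mono) auto
  also have "\<dots> \<le> card (insert {} (insert r ` K))"
    by (intro card_image_le) auto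
  also have "\<dots> \<le> 1 + card (insert r ` K)"
    by (simp add: card_insert_if)
  also have "\<dots> \<le> 1 + card K"
    by (simp add: card_image_le)
  finally have "card (range (word_update g w)) \<le> 1 + card K" .
  moreover have "length fo \<le> CARD('v)"
    by (metis fo(1) distinct_card card_mono finite subset_UNIV)
  then have "length w \<le> 2 * CARD('v)"
    using length_sweep by (simp add: w_def)
  moreover have "word_update g w top_state = top_state"
    by (rule top_fixed) (use fo in \<open>auto simp: w_def sweep_def\<close>)
  then have "top_state \<in> range (word_update g w)" by (metis rangeI)
  ultimately show ?thesis unfolding K_def by blast
qed

end

section \<open>Feedback vertex sets with few traces\<close>

text \<open>The zero sets of states after a sweep are closed under \<open>P\<close>-predecessors; we count their traces on \<open>F\<close>.\<close>

definition trace :: "('v \<times> 'v) set \<Rightarrow> 'v set \<Rightarrow> 'v set \<Rightarrow> 'v set set" where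
  "trace R S F = (\<lambda>Z. Z \<inter> F) ` {Z. Z \<subseteq> S \<and> (\<forall>u\<in>S. \<forall>v\<in>Z. (u, v) \<in> R \<longrightarrow> u \<in> Z)}"

lemma finite_trace: "finite S \<Longrightarrow> finite (trace R S F)"
  unfolding trace_def by (rule finite_imageI) (simp add: finite_subset[of _ "Pow S"] subset_iff)

lemma same_cong: "(\<And>v. v \<in> S \<Longrightarrow> \<sigma> v = \<tau> v) \<Longrightarrow> same E \<sigma> \<inter> S \<times> S = same E \<tau> \<inter> S \<times> S"
  by (auto simp: same_def)

lemma trace_cong: "R \<inter> S \<times> S = R' \<inter> S \<times> S \<Longrightarrow> trace R S F = trace R' S F"
  unfolding trace_def by (rule arg_cong[where f = "image _"]) blast

lemma acyclic_two_arcs: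
  assumes "acyclic R" "(u, v) \<in> R" "(v, u) \<in> R"
  shows False
  using assms by (meson acyclic_def r_into_trancl trancl_trans)

lemma acyclic_three_arcs:
  assumes "acyclic R" "(u, v) \<in> R" "(v, w) \<in> R" "(w, u) \<in> R"
  shows False
  using assms by (meson acyclic_def r_into_trancl trancl_trans)

text \<open>Cycles of length two must be negative, so opposite arcs have opposite signs. The two
  orientations of the triangle then have opposite signs, and one of them is a positive
  cycle.\<close>

lemma no_bidirected_triangle:
  assumes no_pos: "\<And>\<tau>. acyclic (same E \<tau>)"
    and neq: "a \<noteq> b" "b \<noteq> c" "a \<noteq> c"
    and arcs: "(a, b) \<in> arcs E" "(b, a) \<in> arcs E" "(b, c) \<in> arcs E" "(c, b) \<in> arcs E"
      "(a, c) \<in> arcs E" "(c, a) \<in> arcs E"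
  shows False
proof -
  have two: "s = 1 \<longleftrightarrow> t \<noteq> 1" if "(u, v, s) \<in> E" "(v, u, t) \<in> E" "u \<noteq> v" for u v s t
  proof (rule ccontr)
    assume "\<not> (s = 1 \<longleftrightarrow> t \<noteq> 1)"
    then have "(u, v) \<in> same E (\<lambda>x. x = u \<or> s = 1)" "(v, u) \<in> same E (\<lambda>x. x = u \<or> s = 1)"
      using that unfolding same_def by blast+
    then show False using acyclic_two_arcs no_pos by metis
  qed
  have three: "\<not> (s = 1 \<longleftrightarrow> (t = 1 \<longleftrightarrow> q = 1))"
    if "(u, v, s) \<in> E" "(v, w, t) \<in> E" "(w, u, q) \<in> E" "u \<noteq> v" "v \<noteq> w" "u \<noteq> w" for u v w s t q
  proof
    assume *: "s = 1 \<longleftrightarrow> (t = 1 \<longleftrightarrow> q = 1)"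
    \<comment> \<open>The values at \<open>v\<close> and \<open>w\<close> make the two arcs at
      \<open>u\<close> positive; the third arc is then positive exactly when the product of the
      three signs is.\<close>
    define \<tau> where "\<tau> = (\<lambda>x. if x = u then True else if x = v then s = 1 else q = 1)"
    have "(u, v) \<in> same E \<tau>" "(v, w) \<in> same E \<tau>" "(w, u) \<in> same E \<tau>"
      using that * unfolding same_def \<tau>_def by auto
    then show False using acyclic_three_arcs no_pos by metis
  qed
  obtain s1 s2 t1 t2 q1 q2 where st: "(a, b, s1) \<in> E" "(b, a, s2) \<in> E" "(b, c, t1) \<in> E" "(c, b, t2) \<in> E"
      "(c, a, q1) \<in> E" "(a, c, q2) \<in> E"
    using arcs by (auto simp: arcs_def)
  then show False
    using two[OF st(1,2)] two[OF st(3,4)] two[OF st(5,6)] three[OF st(1,3,5)]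
      three[OF st(6,4,2)] neq by blast
qed

lemma acyclic_pair:
  assumes "(a, a) \<notin> R" "(b, b) \<notin> R" "(a, b) \<notin> R"
  shows "acyclic (R \<inter> {a, b} \<times> {a, b})"
proof (rule acyclic_subset)
  show "acyclic ({(b, a)} - {(a, a)})"
    by (cases "a = b") (auto simp: acyclic_insert wf_acyclic)
  show "R \<inter> {a, b} \<times> {a, b} \<subseteq> {(b, a)} - {(a, a)}"
    using assms by auto
qed

text \<open>
  For subtrees with three vertices, adding the root to the feedback vertex set could give a count of 3,
  which exceeds \<open>(\<surd>2)\<^sup>3\<close>.
\<close>

lemma three_vertices_fvs:
  assumes no_pos: "\<And>\<tau>. acyclic (same E \<tau>)" and loopless: "\<And>v. (v, v) \<notin> arcs E"
    and "card S = 3"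
  shows "\<exists>v\<in>S. acyclic (arcs E \<inter> (S - {v}) \<times> (S - {v}))"
proof -
  obtain a b c where S: "S = {a, b, c}" "a \<noteq> b" "b \<noteq> c" "a \<noteq> c"
    using assms(3) by (auto simp: card_3_iff)
  have *: "acyclic (arcs E \<inter> {x, y} \<times> {x, y})" if "\<not> ((x, y) \<in> arcs E \<and> (y, x) \<in> arcs E)" for x y
    using acyclic_pair[of x "arcs E" y] acyclic_pair[of y "arcs E" x] loopless that
    by (auto simp: insert_commute)
  have "S - {a} = {b, c}" "S - {b} = {a, c}" "S - {c} = {a, b}"
    using S by auto
  then show ?thesis
    using no_bidirected_triangle[OF no_pos, of a b c] * S by (metis insertI1 insertI2)
qed

text \<open>A walk that has entered \<open>Y\<close> cannot return to \<open>X\<close>, so a cycle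
  would lie entirely in one of the two sets.\<close>

lemma acyclic_restrict_Un:
  assumes X: "acyclic (R \<inter> X \<times> X)" and Y: "acyclic (R \<inter> Y \<times> Y)"
    and YX: "\<And>y x. y \<in> Y \<Longrightarrow> x \<in> X \<Longrightarrow> (y, x) \<notin> R"
  shows "acyclic (R \<inter> (X \<union> Y) \<times> (X \<union> Y))"
proof -
  define U where "U = R \<inter> (X \<union> Y) \<times> (X \<union> Y)"
  have inY: "y \<in> Y \<and> (x, y) \<in> (R \<inter> Y \<times> Y)\<^sup>+" if "(x, y) \<in> U\<^sup>+" "x \<in> Y" for x y
    using that
  proof (induction rule: trancl_induct)
    case (base y)
    then show ?case using YX by (auto simp: U_def)
  next
    case (step y z)
    then have "(y, z) \<in> R \<inter> Y \<times> Y" using YX by (auto simp: U_def)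
    then show ?case using step by (auto intro: trancl_into_trancl)
  qed
  have inX: "x \<in> X \<and> (x, y) \<in> (R \<inter> X \<times> X)\<^sup>+" if "(x, y) \<in> U\<^sup>+" "y \<in> X" for x y
    using that
  proof (induction rule: converse_trancl_induct)
    case (base y)
    then show ?case using YX by (auto simp: U_def)
  next
    case (step y z)
    then have "(y, z) \<in> R \<inter> X \<times> X" using YX by (auto simp: U_def)
    then show ?case using step by (auto intro: trancl_into_trancl2)
  qed
  have "(x, x) \<notin> U\<^sup>+" for x
  proof
    assume *: "(x, x) \<in> U\<^sup>+"
    then have "x \<in> X \<union> Y"
      by (auto simp: U_def dest: tranclD)
    then show False
      using inX[OF *] inY[OF *] X Y by (auto simp: acyclic_def)
  qed
  then show ?thesis by (auto simp: acyclic_def U_def)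
qed

lemma closed_contains_root:
  assumes "(c, v) \<in> (R \<inter> S \<times> S)\<^sup>*" "v \<in> Z" "\<And>u v. u \<in> S \<Longrightarrow> v \<in> Z \<Longrightarrow> (u, v) \<in> R \<Longrightarrow> u \<in> Z"
  shows "c \<in> Z"
  using assms(1) by (induction rule: converse_rtrancl_induct) (use assms in auto)

text \<open>Since \<open>c\<close> reaches all of \<open>S\<close>, a nonempty closed set contains
  \<open>c\<close>. Recording \<open>c\<close> thus only separates the empty set from the nonempty
  ones.\<close>

lemma card_trace_insert:
  assumes "finite S" and reach: "\<And>v. v \<in> S \<Longrightarrow> (c, v) \<in> (R \<inter> S \<times> S)\<^sup>*"
  shows "card (trace R S (insert c F)) \<le> 1 + card (trace R S F)"
proof -
  have "trace R S (insert c F) \<subseteq> insert {} (insert c ` trace R S F)"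
  proof
    fix C assume "C \<in> trace R S (insert c F)"
    then obtain Z where Z: "Z \<subseteq> S" "\<forall>u\<in>S. \<forall>v\<in>Z. (u, v) \<in> R \<longrightarrow> u \<in> Z" "C = Z \<inter> insert c F"
      by (auto simp: trace_def)
    show "C \<in> insert {} (insert c ` trace R S F)"
    proof (cases "c \<in> Z")
      case True
      then have "C = insert c (Z \<inter> F)" using Z(3) by auto
      moreover have "Z \<inter> F \<in> trace R S F" using Z by (auto simp: trace_def)
      ultimately show ?thesis by blast
    next
      case False
      have "Z = {}"
      proof (rule ccontr)
        assume "Z \<noteq> {}"
        then obtain v where "v \<in> Z" by blast
        then show False
          using closed_contains_root[of c v R S Z] reach Z False by blast
      qed
      then show ?thesis using Z by simp
    qed
  qed
  then have "card (trace R S (insert c F)) \<le> card (insert {} (insert c ` trace R S F))"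
    by (intro card_mono) (auto simp: finite_trace assms)
  also have "\<dots> \<le> 1 + card (insert c ` trace R S F)"
    by (simp add: card_insert_if finite_trace assms)
  also have "\<dots> \<le> 1 + card (trace R S F)"
    by (simp add: card_image_le finite_trace assms)
  finally show ?thesis .
qed

lemma card_trace_singleton: "card (trace R S {v}) \<le> 2"
proof -
  have "card (trace R S {v}) \<le> card {{}, {v}}"
    by (intro card_mono) (auto simp: trace_def)
  also have "\<dots> \<le> 2" by simp
  finally show ?thesis .
qed

text \<open>Including the root of a subtree may cost one more trace, while the bound gains only a
  factor \<open>sqrt 2\<close>. With \<open>q = sqrt 2 ^ (card S - 1)\<close>, the inequality
  \<open>1 + q \<le> sqrt 2 * q\<close> holds from four vertices on; smaller subtrees are treated
  separately.\<close>

lemma fvs_with_root: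
  fixes E :: "'v sdigraph"
  assumes no_pos: "\<And>\<tau>. acyclic (same E \<tau>)" and loopless: "\<And>v. (v, v) \<notin> arcs E"
    and fin: "finite S" and c: "c \<in> S"
    and reach: "\<And>v. v \<in> S \<Longrightarrow> (c, v) \<in> (same E \<sigma> \<inter> S \<times> S)\<^sup>*"
    and F: "F \<subseteq> S - {c}" and ac: "acyclic (arcs E \<inter> (S - F - {c}) \<times> (S - F - {c}))"
    and k: "card (trace (same E \<sigma>) S F) \<le> sqrt 2 ^ (card S - 1)"
  shows "\<exists>F'\<subseteq>S. acyclic (arcs E \<inter> (S - F') \<times> (S - F')) \<and>
    card (trace (same E \<sigma>) S F') \<le> sqrt 2 ^ card S"
proof -
  have pos: "card S > 0" using fin c by (auto simp: card_gt_0_iff)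
  have S_insert: "insert c F \<subseteq> S" "S - insert c F = S - F - {c}" using F c by auto
  have le: "card (trace (same E \<sigma>) S (insert c F)) \<le> 1 + card (trace (same E \<sigma>) S F)"
    using card_trace_insert[OF fin reach] .
  have sqrt8: "sqrt 2 ^ 3 = 2 * sqrt 2" by (simp add: power3_eq_cube)
  have sqrt2: "1 \<le> sqrt 2" by simp
  have sqrt2': "sqrt 2 < 3 / 2" by (rule real_less_lsqrt) (simp_all add: power2_eq_square)
  consider "card S = 1" | "card S = 2" | "card S = 3" | "card S \<ge> 4"
    using pos by linarith
  then show ?thesis
  proof cases
    case 1
    then have S: "S = {c}" using c by (auto simp: card_1_singleton_iff)
    have "trace (same E \<sigma>) S {} \<subseteq> {{}}" by (auto simp: trace_def)
    then have "card (trace (same E \<sigma>) S {}) \<le> card {{} :: 'v set}"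
      by (intro card_mono) auto
    then have "real (card (trace (same E \<sigma>) S {})) \<le> 1" by simp
    also have "\<dots> \<le> sqrt 2 ^ card S" by simp
    finally have "real (card (trace (same E \<sigma>) S {})) \<le> sqrt 2 ^ card S" .
    moreover have "arcs E \<inter> (S - {}) \<times> (S - {}) = {}"
      using S loopless by auto
    ultimately show ?thesis
      by (intro exI[of _ "{}"]) (simp add: acyclic_def)
  next
    case 2
    \<comment> \<open>The count is an integer below 2, hence at most 1, and one more trace is
      allowed.\<close>
    then have "real (card (trace (same E \<sigma>) S F)) < 2" using k sqrt2' by simp
    then have "card (trace (same E \<sigma>) S (insert c F)) \<le> 2" using le by linarith
    then have "real (card (trace (same E \<sigma>) S (insert c F))) \<le> sqrt 2 ^ card S" using 2 by simp
    then show ?thesis using ac S_insert by (intro exI[of _ "insert c F"]) simp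
  next
    case 3
    then obtain v where v: "v \<in> S" "acyclic (arcs E \<inter> (S - {v}) \<times> (S - {v}))"
      using three_vertices_fvs[OF no_pos loopless] by blast
    have "real (card (trace (same E \<sigma>) S {v})) \<le> 2"
      using card_trace_singleton[of "same E \<sigma>" S v] by simp
    also have "\<dots> \<le> sqrt 2 ^ card S" using 3 sqrt8 by simp
    finally show ?thesis using v by (intro exI[of _ "{v}"]) simp
  next
    case 4
    define q where "q = sqrt 2 ^ (card S - 1)"
    have "sqrt 2 ^ 3 \<le> q" unfolding q_def
      by (rule power_increasing) (use 4 in auto)
    then have "2 * sqrt 2 \<le> q" by (simp add: sqrt8)
    then have "(sqrt 2 - 1) * (2 * sqrt 2) \<le> (sqrt 2 - 1) * q"
      using sqrt2 by (intro mult_left_mono) auto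
    moreover have "(sqrt 2 - 1) * (2 * sqrt 2) = 4 - 2 * sqrt 2" by (simp add: algebra_simps)
    ultimately have "1 + q \<le> sqrt 2 * q" using sqrt2' by (simp add: algebra_simps)
    also have "\<dots> = sqrt 2 ^ card S"
      unfolding q_def using pos by (simp flip: power_Suc)
    finally have "real (card (trace (same E \<sigma>) S (insert c F))) \<le> sqrt 2 ^ card S"
      using le k unfolding q_def by linarith
    then show ?thesis using ac S_insert by (intro exI[of _ "insert c F"]) simp
  qed
qed

text \<open>Restricting a closed set to either part leaves it closed there, and the two restricted
  traces determine the whole trace.\<close>

lemma card_trace_Un:
  assumes fin: "finite S" "finite R" and disj: "S \<inter> R = {}" and F: "F1 \<subseteq> S" "F2 \<subseteq> R"
  shows "card (trace A (S \<union> R) (F1 \<union> F2)) \<le> card (trace A S F1) * card (trace A R F2)"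
proof -
  have "trace A (S \<union> R) (F1 \<union> F2) \<subseteq> (\<lambda>(C, D). C \<union> D) ` (trace A S F1 \<times> trace A R F2)"
  proof
    fix C assume "C \<in> trace A (S \<union> R) (F1 \<union> F2)"
    then obtain Z where Z: "Z \<subseteq> S \<union> R" "\<forall>u\<in>S \<union> R. \<forall>v\<in>Z. (u, v) \<in> A \<longrightarrow> u \<in> Z" "C = Z \<inter> (F1 \<union> F2)"
      by (auto simp: trace_def)
    have "(Z \<inter> S) \<inter> F1 \<in> trace A S F1" "(Z \<inter> R) \<inter> F2 \<in> trace A R F2"
      unfolding trace_def using Z by (auto intro!: imageI)
    moreover have "C = ((Z \<inter> S) \<inter> F1) \<union> ((Z \<inter> R) \<inter> F2)"
      using Z(3) F by auto
    ultimately show "C \<in> (\<lambda>(C, D). C \<union> D) ` (trace A S F1 \<times> trace A R F2)"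
      by (intro image_eqI[of _ _ "((Z \<inter> S) \<inter> F1, (Z \<inter> R) \<inter> F2)"]) simp_all
  qed
  then have "card (trace A (S \<union> R) (F1 \<union> F2)) \<le> card ((\<lambda>(C, D). C \<union> D) ` (trace A S F1 \<times> trace A R F2))"
    by (intro card_mono finite_imageI finite_cartesian_product finite_trace fin)
  also have "\<dots> \<le> card (trace A S F1 \<times> trace A R F2)"
    by (intro card_image_le finite_cartesian_product finite_trace fin)
  finally show ?thesis by (simp add: card_cartesian_product)
qed

text \<open>
  Depth-first search: \<open>R\<close> is the subtree of the first child \<open>c\<close> of the root, so the arcs leaving \<open>R\<close>
  inside \<open>S\<close> all end in \<open>r\<close>.
\<close>

lemma switching_with_fvs:
  fixes E :: "'v sdigraph"
  assumes no_pos: "\<And>\<tau>. acyclic (same E \<tau>)" and loopless: "\<And>v. (v, v) \<notin> arcs E"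
    and "finite S" "r \<in> S" "\<And>v. v \<in> S \<Longrightarrow> (r, v) \<in> (arcs E \<inter> S \<times> S)\<^sup>*"
  shows "\<exists>\<sigma> F. (\<forall>v\<in>S. (r, v) \<in> (same E \<sigma> \<inter> S \<times> S)\<^sup>*) \<and> F \<subseteq> S - {r} \<and>
    acyclic (arcs E \<inter> (S - F - {r}) \<times> (S - F - {r})) \<and>
    card (trace (same E \<sigma>) S F) \<le> sqrt 2 ^ (card S - 1)"
  using assms(3-5)
proof (induction "card S" arbitrary: S r rule: less_induct)
  case less
  note fin = \<open>finite S\<close> and reach = less.prems(3)
  show ?case
  proof (cases "S = {r}")
    case True
    have "trace (same E \<sigma>) S {} \<subseteq> {{}}" for \<sigma> by (auto simp: trace_def)
    then have "card (trace (same E \<sigma>) S {}) \<le> card {{} :: 'v set}" for \<sigma>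
      by (intro card_mono) auto
    then show ?thesis
      using True by (intro exI[of _ "\<lambda>_. True"] exI[of _ "{}"]) (auto simp: acyclic_def)
  next
    case False
    then obtain v where v: "v \<in> S" "v \<noteq> r" using less.prems by blast
    have "\<exists>c. c \<noteq> r \<and> (r, c) \<in> arcs E \<inter> S \<times> S"
      using reach[OF v(1)] v(2) by (induction rule: rtrancl_induct) auto
    then obtain c where c: "c \<noteq> r" "c \<in> S" "(r, c) \<in> arcs E" by auto
    define S' where "S' = S - {r}"
    define R where "R = {v. (c, v) \<in> (arcs E \<inter> S' \<times> S')\<^sup>*}"
    have cR: "c \<in> R" by (simp add: R_def)
    have RS: "R \<subseteq> S'"
    proof
      fix v assume "v \<in> R"
      then have "(c, v) \<in> (arcs E \<inter> S' \<times> S')\<^sup>*" by (simp add: R_def)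
      then show "v \<in> S'" by (induction rule: rtrancl_induct) (use c in \<open>auto simp: S'_def\<close>)
    qed
    have rR: "r \<notin> R" using RS by (auto simp: S'_def)
    have finR: "finite R" "finite (S - R)" using RS fin by (auto simp: S'_def intro: finite_subset)
    have leave: "w = r" if "(u, w) \<in> arcs E" "u \<in> R" "w \<in> S - R" for u w
    proof (rule ccontr)
      assume "w \<noteq> r"
      then have "(u, w) \<in> arcs E \<inter> S' \<times> S'" using that RS by (auto simp: S'_def)
      then show False using that by (auto simp: R_def intro: rtrancl_into_rtrancl)
    qed
    have reachR: "(c, v) \<in> (arcs E \<inter> R \<times> R)\<^sup>*" if "v \<in> R" for v
    proof -
      have "(c, v) \<in> (arcs E \<inter> S' \<times> S')\<^sup>*" using that by (simp add: R_def)
      then show ?thesis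
      proof (induction rule: rtrancl_induct)
        case (step y z)
        then have "y \<in> R" "z \<in> R" by (auto simp: R_def intro: rtrancl_into_rtrancl)
        then show ?case using step by (auto intro: rtrancl_into_rtrancl)
      qed simp
    qed
    have reachS: "(r, v) \<in> (arcs E \<inter> (S - R) \<times> (S - R))\<^sup>*" if "v \<in> S - R" for v
    proof -
      have "v \<notin> R \<longrightarrow> (r, v) \<in> (arcs E \<inter> (S - R) \<times> (S - R))\<^sup>*"
        using reach[OF DiffD1[OF that]]
      proof (induction rule: rtrancl_induct)
        case (step y z)
        show ?case
        proof
          assume z: "z \<notin> R"
          show "(r, z) \<in> (arcs E \<inter> (S - R) \<times> (S - R))\<^sup>*"
          proof (cases "y \<in> R")
            case True
            \<comment> \<open>A path can leave \<open>R\<close> inside \<open>S\<close> only by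
              returning to \<open>r\<close>, where it may be restarted.\<close>
            then have "z = r" using leave step z by auto
            then show ?thesis by simp
          next
            case False
            then show ?thesis using step z by (auto intro: rtrancl_into_rtrancl)
          qed
        qed
      qed (use rR in auto)
      then show ?thesis using that by simp
    qed
    have "R \<subset> S" "S - R \<subset> S" using RS c cR less.prems by (auto simp: S'_def)
    then have lt: "card R < card S" "card (S - R) < card S"
      using fin psubset_card_mono by blast+
    obtain \<sigma>1 F1 where 1: "\<And>v. v \<in> S - R \<Longrightarrow> (r, v) \<in> (same E \<sigma>1 \<inter> (S - R) \<times> (S - R))\<^sup>*"
      "F1 \<subseteq> S - R - {r}" "acyclic (arcs E \<inter> (S - R - F1 - {r}) \<times> (S - R - F1 - {r}))"
      "card (trace (same E \<sigma>1) (S - R) F1) \<le> sqrt 2 ^ (card (S - R) - 1)"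
      using less.hyps[OF lt(2) finR(2) _ reachS] rR less.prems by blast
    obtain \<sigma>2 F0 where 2: "\<And>v. v \<in> R \<Longrightarrow> (c, v) \<in> (same E \<sigma>2 \<inter> R \<times> R)\<^sup>*"
      "F0 \<subseteq> R - {c}" "acyclic (arcs E \<inter> (R - F0 - {c}) \<times> (R - F0 - {c}))"
      "card (trace (same E \<sigma>2) R F0) \<le> sqrt 2 ^ (card R - 1)"
      using less.hyps[OF lt(1) finR(1) cR reachR] by blast
    \<comment> \<open>Only \<open>r\<close> is exempted in the larger set, so the feedback vertex
      set of the subtree has to break the cycles through \<open>c\<close> as well.\<close>
    obtain F2 where F2: "F2 \<subseteq> R" "acyclic (arcs E \<inter> (R - F2) \<times> (R - F2))"
      "card (trace (same E \<sigma>2) R F2) \<le> sqrt 2 ^ card R"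
      using fvs_with_root[OF no_pos loopless finR(1) cR 2] by blast
    obtain s where s: "(r, c, s) \<in> E" using c by (auto simp: arcs_def)
    \<comment> \<open>Complementing \<sigma>2 on all of \<open>R\<close> keeps the signs of the arcs
      inside \<open>R\<close>; \<open>b\<close> decides whether to do so, such that the tree arc
      from \<open>r\<close> to \<open>c\<close> becomes positive.\<close>
    define b where "b \<longleftrightarrow> (\<sigma>2 c \<longleftrightarrow> (\<sigma>1 r \<longleftrightarrow> s = 1))"
    define \<sigma> where "\<sigma> = (\<lambda>v. if v \<in> R then \<sigma>2 v = b else \<sigma>1 v)"
    have eq1: "same E \<sigma> \<inter> (S - R) \<times> (S - R) = same E \<sigma>1 \<inter> (S - R) \<times> (S - R)"
      by (rule same_cong) (simp add: \<sigma>_def)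
    have eq2: "same E \<sigma> \<inter> R \<times> R = same E \<sigma>2 \<inter> R \<times> R"
      unfolding same_def \<sigma>_def by auto
    have rc: "(r, c) \<in> same E \<sigma> \<inter> S \<times> S"
      using s c rR cR less.prems unfolding same_def \<sigma>_def b_def by auto
    have "(r, v) \<in> (same E \<sigma> \<inter> S \<times> S)\<^sup>*" if "v \<in> S" for v
    proof (cases "v \<in> R")
      case True
      then have "(c, v) \<in> (same E \<sigma> \<inter> R \<times> R)\<^sup>*" using 2(1) eq2 by simp
      moreover have "same E \<sigma> \<inter> R \<times> R \<subseteq> same E \<sigma> \<inter> S \<times> S" using RS by (auto simp: S'_def)
      ultimately have "(c, v) \<in> (same E \<sigma> \<inter> S \<times> S)\<^sup>*" using rtrancl_mono by blast
      then show ?thesis using rc by (meson converse_rtrancl_into_rtrancl)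
    next
      case False
      then have "(r, v) \<in> (same E \<sigma> \<inter> (S - R) \<times> (S - R))\<^sup>*" using 1(1) eq1 that by simp
      moreover have "same E \<sigma> \<inter> (S - R) \<times> (S - R) \<subseteq> same E \<sigma> \<inter> S \<times> S" by auto
      ultimately show ?thesis using rtrancl_mono by blast
    qed
    moreover have "F1 \<union> F2 \<subseteq> S - {r}" using 1(2) F2(1) RS by (auto simp: S'_def)
    moreover have "acyclic (arcs E \<inter> (S - (F1 \<union> F2) - {r}) \<times> (S - (F1 \<union> F2) - {r}))"
    proof -
      have "S - (F1 \<union> F2) - {r} = (S - R - F1 - {r}) \<union> (R - F2)"
        using 1(2) F2(1) RS by (auto simp: S'_def)
      moreover have "acyclic (arcs E \<inter> ((S - R - F1 - {r}) \<union> (R - F2)) \<times> ((S - R - F1 - {r}) \<union> (R - F2)))"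
        by (rule acyclic_restrict_Un[OF 1(3) F2(2)]) (use leave in auto)
      ultimately show ?thesis by simp
    qed
    moreover have "card (trace (same E \<sigma>) S (F1 \<union> F2)) \<le> sqrt 2 ^ (card S - 1)"
    proof -
      have S: "S = (S - R) \<union> R" using RS by (auto simp: S'_def)
      have "card (trace (same E \<sigma>) ((S - R) \<union> R) (F1 \<union> F2)) \<le>
          card (trace (same E \<sigma>) (S - R) F1) * card (trace (same E \<sigma>) R F2)"
        by (rule card_trace_Un) (use finR 1(2) F2(1) in auto)
      also have "\<dots> = card (trace (same E \<sigma>1) (S - R) F1) * card (trace (same E \<sigma>2) R F2)"
        using trace_cong[OF eq1] trace_cong[OF eq2] by simp
      finally have "real (card (trace (same E \<sigma>) S (F1 \<union> F2))) \<le>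
          real (card (trace (same E \<sigma>1) (S - R) F1)) * real (card (trace (same E \<sigma>2) R F2))"
        using S by (metis of_nat_le_iff of_nat_mult)
      also have "\<dots> \<le> sqrt 2 ^ (card (S - R) - 1) * sqrt 2 ^ card R"
        by (rule mult_mono) (use 1(4) F2(3) in auto)
      also have "\<dots> = sqrt 2 ^ (card S - 1)"
      proof -
        have "card S = card (S - R) + card R"
          using card_Un_disjoint[of "S - R" R] finR S by auto
        moreover have "card (S - R) > 0" using finR rR less.prems by (auto simp: card_gt_0_iff)
        ultimately have "card (S - R) - 1 + card R = card S - 1" by simp
        then show ?thesis by (metis power_add)
      qed
      finally show ?thesis .
    qed
    ultimately show ?thesis by blast
  qed
qed

section \<open>Interaction digraphs of and-or-nets\<close>

text \<open>The predicate \<open>C\<close> is abstract so that it can also be the negation of a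
  disjunction, with the roles of \<open>A\<close> and \<open>B\<close> exchanged. The witness for an
  increase is the indicator of \<open>A\<close> with \<open>j\<close> removed.\<close>

lemma conjunction_increasing_iff:
  assumes C_def: "\<And>x. C x \<longleftrightarrow> (\<forall>k. A k \<longrightarrow> x k) \<and> (\<forall>k. B k \<longrightarrow> \<not> x k)"
    and disjoint: "\<And>k. A k \<Longrightarrow> \<not> B k"
  shows "(\<exists>x. \<not> x j \<and> \<not> C x \<and> C (x(j := True))) \<longleftrightarrow> A j"
proof
  assume "\<exists>x. \<not> x j \<and> \<not> C x \<and> C (x(j := True))"
  then obtain x where x: "\<not> x j" "\<not> C x" "C (x(j := True))" by blast
  show "A j"
  proof (rule ccontr)
    assume "\<not> A j"
    have "x k" if "A k" for k
      using x(3) that \<open>\<not> A j\<close> unfolding C_def by (cases "k = j") auto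
    moreover have "\<not> x k" if "B k" for k
      using x(1,3) that unfolding C_def by (cases "k = j") auto
    ultimately show False using x(2) unfolding C_def by blast
  qed
next
  assume j: "A j"
  define x where "x = (\<lambda>k. A k \<and> k \<noteq> j)"
  have "\<not> x j" "\<not> C x" using j by (auto simp: x_def C_def)
  moreover have "x(j := True) = A" using j by (auto simp: x_def fun_eq_iff)
  then have "C (x(j := True))" using disjoint by (auto simp: C_def)
  ultimately show "\<exists>x. \<not> x j \<and> \<not> C x \<and> C (x(j := True))" by blast
qed

lemma conjunction_decreasing_iff:
  assumes C_def: "\<And>x. C x \<longleftrightarrow> (\<forall>k. A k \<longrightarrow> x k) \<and> (\<forall>k. B k \<longrightarrow> \<not> x k)"
    and disjoint: "\<And>k. A k \<Longrightarrow> \<not> B k"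
  shows "(\<exists>x. \<not> x j \<and> C x \<and> \<not> C (x(j := True))) \<longleftrightarrow> B j"
proof
  assume "\<exists>x. \<not> x j \<and> C x \<and> \<not> C (x(j := True))"
  then obtain x where x: "\<not> x j" "C x" "\<not> C (x(j := True))" by blast
  show "B j"
  proof (rule ccontr)
    assume "\<not> B j"
    have "(x(j := True)) k" if "A k" for k
      using x(2) that unfolding C_def by auto
    moreover have "\<not> (x(j := True)) k" if "B k" for k
      using x(2) that \<open>\<not> B j\<close> unfolding C_def by (cases "k = j") auto
    ultimately show False using x(3) unfolding C_def by blast
  qed
next
  assume j: "B j"
  have "\<not> A j" "C A" using j disjoint by (auto simp: C_def)
  moreover have "\<not> C (A(j := True))" using j by (auto simp: C_def)
  ultimately show "\<exists>x. \<not> x j \<and> C x \<and> \<not> C (x(j := True))" by blast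
qed

lemma interaction_digraph_and_or:
  fixes E :: "'v sdigraph"
  assumes signed: "signed_digraph E" and simple: "\<And>j i. (j, i, 1) \<in> E \<Longrightarrow> (j, i, -1) \<notin> E"
    and f: "\<And>i. is_conjunction E f i \<or> is_disjunction E f i"
  shows "interaction_digraph f = E"
proof -
  have arcs: "((\<exists>x. \<not> x j \<and> \<not> f x i \<and> f (x(j := True)) i) \<longleftrightarrow> (j, i, 1) \<in> E) \<and>
      ((\<exists>x. \<not> x j \<and> f x i \<and> \<not> f (x(j := True)) i) \<longleftrightarrow> (j, i, -1) \<in> E)" for j i
  proof -
    let ?A = "\<lambda>k. (k, i, 1) \<in> E" and ?B = "\<lambda>k. (k, i, -1) \<in> E"
    have AB: "?A k \<Longrightarrow> \<not> ?B k" and BA: "?B k \<Longrightarrow> \<not> ?A k" for k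
      using simple by blast+
    show ?thesis
    proof (cases "is_conjunction E f i")
      case True
      then have C: "f x i \<longleftrightarrow> (\<forall>k. ?A k \<longrightarrow> x k) \<and> (\<forall>k. ?B k \<longrightarrow> \<not> x k)" for x
        by (simp add: is_conjunction_def)
      show ?thesis
        using conjunction_increasing_iff[where C = "\<lambda>x. f x i" and A = ?A and B = ?B, OF C AB]
          conjunction_decreasing_iff[where C = "\<lambda>x. f x i" and A = ?A and B = ?B, OF C AB] by simp
    next
      case False
      then have "is_disjunction E f i" using f by blast
      \<comment> \<open>By De Morgan the negated disjunction is a conjunction; negation also
        exchanges increases and decreases.\<close>
      then have C: "\<not> f x i \<longleftrightarrow> (\<forall>k. ?B k \<longrightarrow> x k) \<and> (\<forall>k. ?A k \<longrightarrow> \<not> x k)" for x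
        by (auto simp: is_disjunction_def)
      show ?thesis
        using conjunction_increasing_iff[where C = "\<lambda>x. \<not> f x i" and A = ?B and B = ?A, OF C BA]
          conjunction_decreasing_iff[where C = "\<lambda>x. \<not> f x i" and A = ?B and B = ?A, OF C BA] by simp
    qed
  qed
  show ?thesis
  proof (rule set_eqI)
    fix e :: "'v \<times> 'v \<times> int"
    obtain j i s where e: "e = (j, i, s)" by (cases e)
    have "(j, i, s) \<in> interaction_digraph f \<longleftrightarrow> s = 1 \<and> (j, i, 1) \<in> E \<or> s = -1 \<and> (j, i, -1) \<in> E"
      unfolding interaction_digraph_def Un_iff mem_Collect_eq prod.inject
        arcs[THEN conjunct1] arcs[THEN conjunct2] by blast
    also have "\<dots> \<longleftrightarrow> (j, i, s) \<in> E"
    proof -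
      have "s = 1 \<or> s = -1" if "(j, i, s) \<in> E"
        using signed that by (force simp: signed_digraph_def)
      then show ?thesis by blast
    qed
    finally show "e \<in> interaction_digraph f \<longleftrightarrow> e \<in> E"
      unfolding e .
  qed
qed

section \<open>Undoing the switching\<close>

text \<open>Conjugation of \<open>h\<close> by the involution that complements the coordinates where
  \<sigma> is false; equality of Booleans serves as that complementation.\<close>

definition switch_net :: "('v \<Rightarrow> bool) \<Rightarrow> 'v bn \<Rightarrow> 'v bn" where
  "switch_net \<sigma> h y i = (h (\<lambda>j. y j = \<sigma> j) i = \<sigma> i)"

lemma word_update_switch_net:
  "word_update (switch_net \<sigma> h) w (\<lambda>i. x i = \<sigma> i) = (\<lambda>i. word_update h w x i = \<sigma> i)"
proof (induction w arbitrary: x)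
  case (Cons k w)
  have eq: "(\<lambda>i. x i = \<sigma> i)(k := switch_net \<sigma> h (\<lambda>i. x i = \<sigma> i) k) = (\<lambda>i. (x(k := h x k)) i = \<sigma> i)"
  proof -
    have "(\<lambda>j. (x j = \<sigma> j) = \<sigma> j) = x" by auto
    then show ?thesis by (auto simp: switch_net_def)
  qed
  show ?case
    by (simp only: word_update_Cons eq Cons.IH)
qed simp

lemma synchronizing_switch_net:
  assumes "synchronizing h w"
  shows "synchronizing (switch_net \<sigma> h) w"
proof -
  obtain c where c: "\<And>x. word_update h w x = c"
    using assms by (auto simp: synchronizing_def)
  have "word_update (switch_net \<sigma> h) w y = (\<lambda>i. c i = \<sigma> i)" for y
  proof -
    have "(\<lambda>i. (y i = \<sigma> i) = \<sigma> i) = y" by auto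
    then show ?thesis
      using word_update_switch_net[of \<sigma> h w "\<lambda>i. y i = \<sigma> i"] c by simp
  qed
  then show ?thesis by (auto simp: synchronizing_def)
qed

text \<open>Where \<sigma> is true the local function stays a disjunction; where it is false the
  output is negated, and De Morgan gives a conjunction.\<close>

lemma switch_net_and_or:
  assumes signed: "signed_digraph E"
  shows "is_conjunction E (switch_net \<sigma> (net (same E \<sigma>) (diff E \<sigma>))) i \<or>
    is_disjunction E (switch_net \<sigma> (net (same E \<sigma>) (diff E \<sigma>))) i"
proof -
  have same: "(j, i) \<in> same E \<sigma> \<longleftrightarrow> ((j, i, 1) \<in> E \<and> \<sigma> j = \<sigma> i) \<or> ((j, i, -1) \<in> E \<and> \<sigma> j \<noteq> \<sigma> i)" for j
    using signed unfolding same_def signed_digraph_def by force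
  have diff: "(j, i) \<in> diff E \<sigma> \<longleftrightarrow> ((j, i, 1) \<in> E \<and> \<sigma> j \<noteq> \<sigma> i) \<or> ((j, i, -1) \<in> E \<and> \<sigma> j = \<sigma> i)" for j
    using signed unfolding diff_def signed_digraph_def by force
  show ?thesis
  proof (cases "\<sigma> i")
    case True
    have "is_disjunction E (switch_net \<sigma> (net (same E \<sigma>) (diff E \<sigma>))) i"
      unfolding is_disjunction_def switch_net_def net_def same diff using True by blast
    then show ?thesis ..
  next
    case False
    have "is_conjunction E (switch_net \<sigma> (net (same E \<sigma>) (diff E \<sigma>))) i"
      unfolding is_conjunction_def switch_net_def net_def same diff using False by blast
    then show ?thesis ..
  qed
qed

section \<open>Choice of the root and the length bound\<close>

text \<open>Each vertex of a cycle has its unique in-neighbour on that cycle, so walking backwards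
  never leaves it; strong connectivity then puts every vertex on it.\<close>

lemma single_in_neighbours_cycle:
  fixes E :: "('v::finite) sdigraph"
  assumes sc: "strongly_connected E" and single: "\<And>i j k. (j, i) \<in> arcs E \<Longrightarrow> (k, i) \<in> arcs E \<Longrightarrow> j = k"
    and simple: "\<And>j i s t. (j, i, s) \<in> E \<Longrightarrow> (j, i, t) \<in> E \<Longrightarrow> s = t"
    and cyc: "\<not> acyclic (arcs E)"
  shows "digraph_is_cycle E"
proof -
  obtain vs where vs: "vs \<noteq> []" "distinct vs"
    "\<And>m. m < length vs \<Longrightarrow> (vs ! m, vs ! ((m + 1) mod length vs)) \<in> arcs E"
    using cyclic_imp_simple_cycle[OF cyc] by blast
  define n where "n = length vs"
  have n: "n > 0" using vs by (simp add: n_def)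
  have pred: "\<exists>m<n. vs ! ((m + 1) mod n) = v \<and> j = vs ! m" if "v \<in> set vs" "(j, v) \<in> arcs E" for j v
  proof -
    obtain q where q: "q < n" "v = vs ! q" using \<open>v \<in> set vs\<close> by (auto simp: in_set_conv_nth n_def)
    define m where "m = (if q = 0 then n - 1 else q - 1)"
    have m: "m < n" "(m + 1) mod n = q" using q n by (auto simp: m_def)
    then have "(vs ! m, v) \<in> arcs E" using vs(3)[of m] q by (simp add: n_def)
    then show ?thesis using m q single that by blast
  qed
  have all: "v \<in> set vs" for v
  proof -
    have "(v, vs ! 0) \<in> (arcs E)\<^sup>*" using sc by (auto simp: strongly_connected_def)
    then show ?thesis
    proof (induction rule: converse_rtrancl_induct)
      case base
      then show ?case using n by (auto simp: n_def)
    next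
      case (step y z)
      then show ?case using pred by (metis n_def nth_mem)
    qed
  qed
  define sg where "sg = (\<lambda>m. SOME s. (vs ! m, vs ! ((m + 1) mod n), s) \<in> E)"
  have sg: "(vs ! m, vs ! ((m + 1) mod n), sg m) \<in> E" if "m < n" for m
    unfolding sg_def by (rule someI_ex) (use vs(3) that in \<open>auto simp: arcs_def n_def\<close>)
  have "is_cycle E vs (map sg [0..<n])"
    using vs sg by (auto simp: is_cycle_def n_def)
  moreover have "E = {(vs ! m, vs ! ((m + 1) mod length vs), map sg [0..<n] ! m) | m. m < length vs}"
  proof (intro equalityI subsetI)
    fix e assume e: "e \<in> E"
    obtain j v s where js: "e = (j, v, s)" by (cases e)
    then have "(j, v) \<in> arcs E" using e by (auto simp: arcs_def)
    then obtain m where m: "m < n" "vs ! ((m + 1) mod n) = v" "j = vs ! m"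
      using pred all by blast
    then have "s = sg m" using sg[of m] simple e js by metis
    then show "e \<in> {(vs ! m, vs ! ((m + 1) mod length vs), map sg [0..<n] ! m) | m. m < length vs}"
      using m js by (auto simp: n_def intro!: exI[of _ m])
  next
    fix e assume "e \<in> {(vs ! m, vs ! ((m + 1) mod length vs), map sg [0..<n] ! m) | m. m < length vs}"
    then show "e \<in> E" using sg by (auto simp: n_def)
  qed
  ultimately show ?thesis
    using all unfolding digraph_is_cycle_def by blast
qed

lemma arcs_remove_loops: "arcs {(u, v, s) \<in> E. u \<noteq> v} = arcs E - Id"
  by (auto simp: arcs_def)

lemma same_remove_loops: "same {(u, v, s) \<in> E. u \<noteq> v} \<sigma> \<subseteq> same E \<sigma>"
  by (auto simp: same_def)

lemma rtrancl_minus_Id: "(R - Id)\<^sup>* = R\<^sup>*"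
  by (simp add: rtrancl_r_diff_Id)

text \<open>The search is run on the digraph without loops, which has the same reachability. The
  feedback vertex set is transferred only when there was no loop to remove.\<close>

lemma rooted_switching:
  fixes E :: "('v::finite) sdigraph"
  assumes no_pos: "\<And>\<tau>. acyclic (same E \<tau>)" and sc: "strongly_connected E"
  shows "\<exists>\<sigma>. rooted_net (same E \<sigma>) (diff E \<sigma>) r \<and>
    ((\<forall>v. (v, v) \<notin> arcs E) \<longrightarrow> (\<exists>F. r \<notin> F \<and> acyclic (arcs E \<inter> (- F - {r}) \<times> (- F - {r})) \<and>
      card (trace (same E \<sigma>) UNIV F) \<le> sqrt 2 ^ (CARD('v) - 1)))"
proof -
  define E' where "E' = {(u, v, s) \<in> E. u \<noteq> v}"
  have ac': "acyclic (same E' \<tau>)" for \<tau>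
    using acyclic_subset[OF no_pos same_remove_loops] by (simp add: E'_def)
  have loopless: "(v, v) \<notin> arcs E'" for v
    by (simp add: E'_def arcs_remove_loops)
  have reach: "(r, v) \<in> (arcs E' \<inter> UNIV \<times> UNIV)\<^sup>*" for v
    using sc by (simp add: strongly_connected_def E'_def arcs_remove_loops rtrancl_minus_Id)
  obtain \<sigma> F where F: "\<forall>v\<in>UNIV. (r, v) \<in> (same E' \<sigma> \<inter> UNIV \<times> UNIV)\<^sup>*" "F \<subseteq> UNIV - {r}"
    "acyclic (arcs E' \<inter> (UNIV - F - {r}) \<times> (UNIV - F - {r}))"
    "card (trace (same E' \<sigma>) UNIV F) \<le> sqrt 2 ^ (CARD('v) - 1)"
    using switching_with_fvs[OF ac' loopless finite UNIV_I reach] by blast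
  have \<sigma>: "(r, v) \<in> (same E' \<sigma>)\<^sup>*" for v
    using F(1) by simp
  have "rooted_net (same E \<sigma>) (diff E \<sigma>) r"
  proof
    fix Q v
    \<comment> \<open>Switching by \<sigma> and then by \<open>Q\<close> amounts to one
      switching.\<close>
    have "{(u, v) \<in> same E \<sigma>. u \<in> Q \<longleftrightarrow> v \<in> Q} \<union> {(u, v) \<in> diff E \<sigma>. \<not> (u \<in> Q \<longleftrightarrow> v \<in> Q)}
        \<subseteq> same E (\<lambda>v. \<sigma> v = (v \<in> Q))"
      unfolding same_def diff_def by blast
    then show "acyclic ({(u, v) \<in> same E \<sigma>. u \<in> Q \<longleftrightarrow> v \<in> Q} \<union> {(u, v) \<in> diff E \<sigma>. \<not> (u \<in> Q \<longleftrightarrow> v \<in> Q)})"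
      using no_pos acyclic_subset by blast
    show "(r, v) \<in> (same E \<sigma>)\<^sup>*"
      using \<sigma>[of v] rtrancl_mono[OF same_remove_loops[of E \<sigma>]] by (auto simp: E'_def)
  qed
  moreover have "E' = E" if "\<forall>v. (v, v) \<notin> arcs E"
    using that by (auto simp: E'_def arcs_def)
  ultimately show ?thesis
    using F(2-4) by (intro exI[of _ \<sigma>]) (auto simp: Compl_eq_Diff_UNIV intro!: exI[of _ F])
qed

text \<open>With \<open>i\<close> as root there is a path of positive arcs from \<open>i\<close> to
  \<open>j\<close>. Of two parallel arcs with opposite signs, one is positive after switching and
  closes this path to a cycle.\<close>

lemma same_diff_disjoint:
  fixes E :: "('v::finite) sdigraph"
  assumes no_pos: "\<And>\<tau>. acyclic (same E \<tau>)" and sc: "strongly_connected E"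
    and "(j, i, s) \<in> E" "(j, i, t) \<in> E" "s = 1" "t \<noteq> 1"
  shows False
proof -
  obtain \<sigma> where "rooted_net (same E \<sigma>) (diff E \<sigma>) i"
    using rooted_switching[OF no_pos sc] by blast
  then have "(i, j) \<in> (same E \<sigma>)\<^sup>*" by (rule rooted_net.root)
  moreover have "(j, i) \<in> same E \<sigma>"
    using assms(3-6) unfolding same_def by blast
  ultimately show False
    using no_pos[of \<sigma>] by (auto simp: acyclic_def dest: rtrancl_into_trancl1)
qed

text \<open>With \<open>q = sqrt 2 ^ (n - 1)\<close>, at most \<open>1 + q\<close> states remain
  after \<open>2 * n\<close> steps, and merging them takes at most \<open>4 * n * q\<close> more.
  The total is at most \<open>6 * n * q\<close>, and \<open>6 / 5 \<le> sqrt 2\<close> turns this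
  into the claimed bound.\<close>

lemma synchronizing_net:
  fixes E :: "('v::finite) sdigraph"
  assumes no_pos: "\<And>\<tau>. acyclic (same E \<tau>)" and sc: "strongly_connected E"
    and j: "(j1, r) \<in> arcs E" "(j2, r) \<in> arcs E" "j1 \<noteq> j2"
    and loop: "\<And>v. (v, v) \<in> arcs E \<Longrightarrow> (r, r) \<in> arcs E"
  shows "\<exists>\<sigma> w. synchronizing (net (same E \<sigma>) (diff E \<sigma>)) w \<and>
    real (length w) \<le> 5 * real (CARD('v)) * sqrt 2 ^ CARD('v)"
proof -
  obtain \<sigma> where \<sigma>: "rooted_net (same E \<sigma>) (diff E \<sigma>) r"
    and fvs: "(\<forall>v. (v, v) \<notin> arcs E) \<longrightarrow> (\<exists>F. r \<notin> F \<and> acyclic (arcs E \<inter> (- F - {r}) \<times> (- F - {r})) \<and>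
      card (trace (same E \<sigma>) UNIV F) \<le> sqrt 2 ^ (CARD('v) - 1))"
    using rooted_switching[OF no_pos sc] by blast
  interpret rooted_net "same E \<sigma>" "diff E \<sigma>" r by (rule \<sigma>)
  have arcs_eq: "arcs E = same E \<sigma> \<union> diff E \<sigma>"
    by (auto simp: arcs_def same_def diff_def)
  have j': "(j1, r) \<in> diff E \<sigma>" "(j2, r) \<in> diff E \<sigma>"
    using j no_P_into_root arcs_eq by auto
  have ge1: "1 \<le> sqrt 2 ^ k" for k by simp
  obtain w0 where w0: "length w0 \<le> 2 * CARD('v)" "top_state \<in> range (word_update g w0)"
    "real (card (range (word_update g w0))) \<le> 1 + sqrt 2 ^ (CARD('v) - 1)"
  proof (cases "(r, r) \<in> arcs E")
    case True
    then have "(r, r) \<in> diff E \<sigma>" using no_P_into_root arcs_eq by auto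
    then obtain w where w: "length w \<le> 2 * CARD('v)" "card (range (word_update g w)) \<le> 2"
      "top_state \<in> range (word_update g w)"
      using initial_loop by blast
    then have "real (card (range (word_update g w))) \<le> 2" by linarith
    then show ?thesis using that[of w] w ge1[of "CARD('v) - 1"] by linarith
  next
    case False
    then obtain F where F: "r \<notin> F" "acyclic (arcs E \<inter> (- F - {r}) \<times> (- F - {r}))"
      "card (trace (same E \<sigma>) UNIV F) \<le> sqrt 2 ^ (CARD('v) - 1)"
      using fvs loop by blast
    have "trace (same E \<sigma>) UNIV F = (\<lambda>Z. Z \<inter> F) ` {Z. \<forall>u. \<forall>v\<in>Z. (u, v) \<in> same E \<sigma> \<longrightarrow> u \<in> Z}"
      by (simp add: trace_def)
    then obtain w where "length w \<le> 2 * CARD('v)" "top_state \<in> range (word_update g w)"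
      "card (range (word_update g w)) \<le> 1 + card (trace (same E \<sigma>) UNIV F)"
      using initial_fvs[OF F(1)] F(2) arcs_eq by auto
    then show ?thesis using that[of w] F(3) by linarith
  qed
  obtain w1 where w1: "length w1 \<le> 4 * CARD('v) * (card (range (word_update g w0)) - 1)"
    "word_update g w1 ` range (word_update g w0) = {top_state}"
    using synchronize_set[OF j' j(3) w0(2)] by blast
  have "word_update g (w0 @ w1) x = top_state" for x
    using w1(2) by auto
  then have sync: "synchronizing g (w0 @ w1)" by (auto simp: synchronizing_def)
  define n where "n = CARD('v)"
  define q where "q = sqrt 2 ^ (n - 1)"
  have n: "n > 0" by (simp add: n_def)
  then have qn: "sqrt 2 ^ n = sqrt 2 * q" unfolding q_def by (simp flip: power_Suc)
  have cpos: "card (range (word_update g w0)) > 0" using w0(2) by (auto simp: card_gt_0_iff)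
  then have card1: "real (card (range (word_update g w0)) - 1) \<le> q"
    using w0(3) by (simp add: q_def n_def)
  have "real (length (w0 @ w1)) \<le> 2 * real n + real (4 * n * (card (range (word_update g w0)) - 1))"
    using w0(1) w1(1) unfolding n_def by (simp del: of_nat_mult of_nat_diff flip: of_nat_add)
  also have "\<dots> = 2 * real n + 4 * real n * real (card (range (word_update g w0)) - 1)" by simp
  also have "\<dots> \<le> 2 * real n + 4 * real n * q"
    using card1 by (intro add_left_mono mult_left_mono) auto
  also have "\<dots> \<le> real n * (6 * q)"
    using mult_left_mono[OF ge1[of "n - 1"], of "2 * real n"] by (simp add: q_def algebra_simps)
  also have "\<dots> \<le> real n * (5 * (sqrt 2 * q))"
  proof -
    have "6 / 5 \<le> sqrt 2" by (rule real_le_rsqrt) (simp add: power2_eq_square)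
    then have "6 / 5 * q \<le> sqrt 2 * q" by (rule mult_right_mono) (simp add: q_def)
    then show ?thesis by (intro mult_left_mono) auto
  qed
  also have "\<dots> = 5 * real n * sqrt 2 ^ n" by (simp add: qn)
  finally show ?thesis using sync unfolding n_def by blast
qed

theorem theorem2:
  fixes E :: "('v::finite) sdigraph"
  assumes "signed_digraph E"
    and "strongly_connected E"
    and "\<not> has_positive_cycle E"
    and "\<not> digraph_is_cycle E"
  shows "\<exists>f. and_or_net E f \<and>
           (\<exists>w. synchronizing f w \<and>
                real (length w) \<le> 5 * real (CARD('v)) * sqrt 2 ^ CARD('v))"
proof -
  note no_pos = acyclic_same[OF assms(1,3)] and sc = assms(2)
  have simple: "s = t" if "(j, i, s) \<in> E" "(j, i, t) \<in> E" for j i s t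
  proof (rule ccontr)
    assume "s \<noteq> t"
    moreover have "s = 1 \<or> s = -1" "t = 1 \<or> t = -1"
      using assms(1) that by (force simp: signed_digraph_def)+
    ultimately show False
      using same_diff_disjoint[OF no_pos sc that] same_diff_disjoint[OF no_pos sc that(2,1)] by auto
  qed
  have "\<exists>\<sigma> w. synchronizing (net (same E \<sigma>) (diff E \<sigma>)) w \<and>
    real (length w) \<le> 5 * real (CARD('v)) * sqrt 2 ^ CARD('v)"
  proof (cases "\<exists>i j k. (j, i) \<in> arcs E \<and> (k, i) \<in> arcs E \<and> j \<noteq> k")
    case True
    then obtain i j k where ijk: "(j, i) \<in> arcs E" "(k, i) \<in> arcs E" "j \<noteq> k" by blast
    show ?thesis
    proof (cases "\<exists>v. (v, v) \<in> arcs E")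
      case True
      then obtain v where v: "(v, v) \<in> arcs E" by blast
      \<comment> \<open>The looped vertex \<open>v\<close> serves as root, with itself as one
        in-neighbour; the last arc of a path entering \<open>v\<close> from another vertex yields
        the second.\<close>
      have "\<exists>u. u \<noteq> v"
        using ijk(3) by metis
      then obtain u where u: "u \<noteq> v" by blast
      have "(u, v) \<in> (arcs E)\<^sup>*" using sc by (auto simp: strongly_connected_def)
      then have "\<exists>u'. u' \<noteq> v \<and> (u', v) \<in> arcs E"
        using u
        by (induction rule: converse_rtrancl_induct) blast+
      then obtain u' where "(u', v) \<in> arcs E" "v \<noteq> u'" by blast
      then show ?thesis
        using synchronizing_net[OF no_pos sc v] v by blast
    next
      case False
      then show ?thesis
        using synchronizing_net[OF no_pos sc ijk] by blast
    qed
  next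
    case False
    have ac: "acyclic (arcs E)"
    proof (rule ccontr)
      assume "\<not> acyclic (arcs E)"
      then have "digraph_is_cycle E"
        using False by (intro single_in_neighbours_cycle[OF sc]) (blast, erule simple)
      then show False using assms(4) by simp
    qed
    \<comment> \<open>No vertex has two in-neighbours and there is no cycle, so strong connectivity
      leaves a single vertex without arcs. Its local function is the empty disjunction, and one
      update synchronizes.\<close>
    have eq: "u = v" for u v :: 'v
      using sc acyclic_impl_antisym_rtrancl[OF ac] unfolding strongly_connected_def antisym_def by blast
    have empty: "arcs E = {}"
      using ac eq unfolding acyclic_def by (metis ex_in_conv r_into_trancl surj_pair)
    define v where "v = (undefined :: 'v)"
    have "same E \<tau> = {}" "diff E \<tau> = {}" for \<tau>
      using empty by (auto simp: arcs_def same_def diff_def)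
    then have "word_update (net (same E (\<lambda>_. True)) (diff E (\<lambda>_. True))) [v] x = (\<lambda>_. False)" for x
      using eq[of _ v] by (simp add: net_def fun_eq_iff)
    then have "synchronizing (net (same E (\<lambda>_. True)) (diff E (\<lambda>_. True))) [v]"
      by (auto simp: synchronizing_def)
    moreover have "real (length [v]) \<le> 5 * real (CARD('v)) * sqrt 2 ^ CARD('v)"
    proof -
      have "1 * 1 \<le> real (CARD('v)) * sqrt 2 ^ CARD('v)"
        by (rule mult_mono) (auto simp: Suc_le_eq)
      then show ?thesis by simp
    qed
    ultimately show ?thesis by blast
  qed
  then obtain \<sigma> w where \<sigma>: "synchronizing (net (same E \<sigma>) (diff E \<sigma>)) w"
    "real (length w) \<le> 5 * real (CARD('v)) * sqrt 2 ^ CARD('v)" by blast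
  have "and_or_net E (switch_net \<sigma> (net (same E \<sigma>) (diff E \<sigma>)))"
    unfolding and_or_net_def
  proof (intro conjI allI)
    show "interaction_digraph (switch_net \<sigma> (net (same E \<sigma>) (diff E \<sigma>))) = E"
    proof (rule interaction_digraph_and_or[OF assms(1) _ switch_net_and_or[OF assms(1)]])
      fix j i
      assume "(j, i, 1) \<in> E"
      then show "(j, i, -1) \<notin> E" using simple[of j i 1 "-1"] by auto
    qed
  qed (rule switch_net_and_or[OF assms(1)])
  then show ?thesis
    using synchronizing_switch_net[OF \<sigma>(1)] \<sigma>(2) by blast
qed

end
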